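(* Let $G$ be a graph (possibly with parallel edges) which is the edge-disjoint union of a spanning tree $T$ and an odd pseudoforest $P$. Then $G$ has an orientation containing no closed antidirected trail. Moreover, such an orientation can be constructed in linear time given $T$ and $P$.
   Context: Graphs are finite and loopless. A pseudoforest is a graph in which each connected component contains at most one cycle; an odd pseudoforest is a pseudoforest in which every cycle has odd length. An orientation of $G$ replaces each edge by an arc joining its ends. In a walk (in the underlying graph) of a digraph an arc $vw$ is forward if traversed from $v$ to $w$ and backward if traversed from $w$ to $v$. A closed antidirected trail is a closed walk of even length with no repeated arc whose arcs alternate between forward and backward arcs. *)

theory Defs
  imports Main "Graph_Theory.Digraph"
begin

section \<open>Undirected multigraphs\<close>

text \<open>
  The graphs of \<^theory>\<open>Graph_Theory.Digraph\<close> are symmetric digraphs, which do not fit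
  orientations of undirected multigraphs. An edge here is an atomic object with a set of ends, so
  distinct edges may be parallel. Digraphs (the orientations) are the library's.
\<close>

record ('v, 'e) multigraph =
  mverts :: "'v set"
  medges :: "'e set"
  ends :: "'e \<Rightarrow> 'v set"

definition finite_loopless :: "('v, 'e) multigraph \<Rightarrow> bool" where
  "finite_loopless G \<longleftrightarrow> finite (mverts G) \<and> finite (medges G) \<and>
     (\<forall>e\<in>medges G. ends G e \<subseteq> mverts G \<and> card (ends G e) = 2)"

definition submultigraph :: "('v, 'e) multigraph \<Rightarrow> ('v, 'e) multigraph \<Rightarrow> bool" where
  "submultigraph H G \<longleftrightarrow> finite_loopless H \<and> mverts H \<subseteq> mverts G \<and> medges H \<subseteq> medges G \<and>
     (\<forall>e\<in>medges H. ends H e = ends G e)"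

definition walk :: "('v, 'e) multigraph \<Rightarrow> 'v list \<Rightarrow> 'e list \<Rightarrow> bool" where
  "walk G vs es \<longleftrightarrow> length vs = Suc (length es) \<and> set vs \<subseteq> mverts G \<and> set es \<subseteq> medges G \<and>
     (\<forall>i<length es. ends G (es ! i) = {vs ! i, vs ! Suc i})"

definition reachable_in :: "('v, 'e) multigraph \<Rightarrow> 'v \<Rightarrow> 'v \<Rightarrow> bool" where
  "reachable_in G u v \<longleftrightarrow> (\<exists>vs es. walk G vs es \<and> hd vs = u \<and> last vs = v)"

definition connected_multigraph :: "('v, 'e) multigraph \<Rightarrow> bool" where
  "connected_multigraph G \<longleftrightarrow> mverts G \<noteq> {} \<and> (\<forall>u\<in>mverts G. \<forall>v\<in>mverts G. reachable_in G u v)"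

definition component_of :: "('v, 'e) multigraph \<Rightarrow> 'v \<Rightarrow> ('v, 'e) multigraph" where
  "component_of G v = (let K = {w. reachable_in G v w}
     in \<lparr>mverts = K, medges = {e \<in> medges G. ends G e \<subseteq> K}, ends = ends G\<rparr>)"

definition components :: "('v, 'e) multigraph \<Rightarrow> ('v, 'e) multigraph set" where
  "components G = component_of G ` mverts G"

text \<open>
  A cycle is identified with its edge set, so that the same cycle traversed from another start or
  in the other direction is not counted twice. Two parallel edges form a cycle of length 2.
\<close>

definition cycle_edges :: "('v, 'e) multigraph \<Rightarrow> 'e set \<Rightarrow> bool" where
  "cycle_edges G C \<longleftrightarrow> (\<exists>vs es. walk G vs es \<and> length es \<ge> 2 \<and> hd vs = last vs \<and>
     distinct (tl vs) \<and> distinct es \<and> C = set es)"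

definition tree_multigraph :: "('v, 'e) multigraph \<Rightarrow> bool" where
  "tree_multigraph G \<longleftrightarrow> finite_loopless G \<and> connected_multigraph G \<and> (\<nexists>C. cycle_edges G C)"

definition spanning_tree_of :: "('v, 'e) multigraph \<Rightarrow> ('v, 'e) multigraph \<Rightarrow> bool" where
  "spanning_tree_of T G \<longleftrightarrow> submultigraph T G \<and> tree_multigraph T \<and> mverts T = mverts G"

definition pseudoforest :: "('v, 'e) multigraph \<Rightarrow> bool" where
  "pseudoforest G \<longleftrightarrow> finite_loopless G \<and>
     (\<forall>K\<in>components G. \<forall>C C'. cycle_edges K C \<and> cycle_edges K C' \<longrightarrow> C = C')"

definition odd_pseudoforest :: "('v, 'e) multigraph \<Rightarrow> bool" where
  "odd_pseudoforest G \<longleftrightarrow> pseudoforest G \<and> (\<forall>C. cycle_edges G C \<longrightarrow> odd (card C))"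

definition edge_disjoint_union ::
    "('v, 'e) multigraph \<Rightarrow> ('v, 'e) multigraph \<Rightarrow> ('v, 'e) multigraph \<Rightarrow> bool" where
  "edge_disjoint_union G H K \<longleftrightarrow> submultigraph H G \<and> submultigraph K G \<and>
     mverts G = mverts H \<union> mverts K \<and> medges G = medges H \<union> medges K \<and>
     medges H \<inter> medges K = {}"


section \<open>Orientations and antidirected trails\<close>

definition underlying :: "('v, 'e) pre_digraph \<Rightarrow> ('v, 'e) multigraph" where
  "underlying D = \<lparr>mverts = verts D, medges = arcs D, ends = (\<lambda>e. {tail D e, head D e})\<rparr>"

definition orientation_of :: "('v, 'e) pre_digraph \<Rightarrow> ('v, 'e) multigraph \<Rightarrow> bool" where
  "orientation_of D G \<longleftrightarrow> verts D = mverts G \<and> arcs D = medges G \<and>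
     (\<forall>e\<in>medges G. {tail D e, head D e} = ends G e)"

definition forward_step :: "('v, 'e) pre_digraph \<Rightarrow> 'v list \<Rightarrow> 'e list \<Rightarrow> nat \<Rightarrow> bool" where
  "forward_step D vs es i \<longleftrightarrow> tail D (es ! i) = vs ! i \<and> head D (es ! i) = vs ! Suc i"

definition backward_step :: "('v, 'e) pre_digraph \<Rightarrow> 'v list \<Rightarrow> 'e list \<Rightarrow> nat \<Rightarrow> bool" where
  "backward_step D vs es i \<longleftrightarrow> head D (es ! i) = vs ! i \<and> tail D (es ! i) = vs ! Suc i"

text \<open>
  The trail is nontrivial: it has at least one arc. Since the length is even, alternation also
  holds between the last and the first arc.
\<close>

definition closed_antidirected_trail ::
    "('v, 'e) pre_digraph \<Rightarrow> 'v list \<Rightarrow> 'e list \<Rightarrow> bool" where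
  "closed_antidirected_trail D vs es \<longleftrightarrow> walk (underlying D) vs es \<and> es \<noteq> [] \<and>
     hd vs = last vs \<and> even (length es) \<and> distinct es \<and>
     (\<forall>i. Suc i < length es \<longrightarrow>
        forward_step D vs es i \<and> backward_step D vs es (Suc i) \<or>
        backward_step D vs es i \<and> forward_step D vs es (Suc i))"


section \<open>Linear time on a word RAM\<close>

text \<open>
  Programs are finite syntactic objects over registers and arrays named by numerals; a program can
  mention only finitely many of either. A machine word is a number at most the bound \<open>W\<close>; a step
  whose result is larger has no successor state. Every elementary instruction and every
  evaluation of a test takes one unit of time. There is no multiplication.
\<close>

record ram_state =
  reg :: "nat \<Rightarrow> nat"
  arr :: "nat \<Rightarrow> nat \<Rightarrow> nat"

datatype instr =
    Const nat nat      \<comment> \<open>\<open>Const x k\<close>: register \<open>x\<close> becomes the constant \<open>k\<close>\<close>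
  | Move nat nat       \<comment> \<open>\<open>Move x y\<close>: \<open>x := y\<close>\<close>
  | Plus nat nat nat   \<comment> \<open>\<open>Plus x y z\<close>: \<open>x := y + z\<close>\<close>
  | Minus nat nat nat  \<comment> \<open>\<open>Minus x y z\<close>: \<open>x := y - z\<close>, truncated at 0\<close>
  | Load nat nat nat   \<comment> \<open>\<open>Load x a y\<close>: register \<open>x\<close> becomes entry \<open>y\<close> (a register) of array \<open>a\<close>\<close>
  | Store nat nat nat  \<comment> \<open>\<open>Store a y x\<close>: entry \<open>y\<close> (a register) of array \<open>a\<close> becomes register \<open>x\<close>\<close>

datatype test = Less nat nat | Equal nat nat

datatype prog =
    Do instr
  | Seq prog prog
  | Cond test prog prog
  | Loop test prog     \<comment> \<open>repeat the body while the test holds\<close>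

definition set_reg :: "nat \<Rightarrow> nat \<Rightarrow> nat \<Rightarrow> ram_state \<Rightarrow> ram_state option" where
  "set_reg W x k s = (if k \<le> W then Some (s\<lparr>reg := (reg s)(x := k)\<rparr>) else None)"

fun instr_step :: "nat \<Rightarrow> instr \<Rightarrow> ram_state \<Rightarrow> ram_state option" where
  "instr_step W (Const x k) s = set_reg W x k s"
| "instr_step W (Move x y) s = set_reg W x (reg s y) s"
| "instr_step W (Plus x y z) s = set_reg W x (reg s y + reg s z) s"
| "instr_step W (Minus x y z) s = set_reg W x (reg s y - reg s z) s"
| "instr_step W (Load x a y) s = set_reg W x (arr s a (reg s y)) s"
| "instr_step W (Store a y x) s =
     Some (s\<lparr>arr := (arr s)(a := (arr s a)(reg s y := reg s x))\<rparr>)"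

fun test_holds :: "test \<Rightarrow> ram_state \<Rightarrow> bool" where
  "test_holds (Less x y) s \<longleftrightarrow> reg s x < reg s y"
| "test_holds (Equal x y) s \<longleftrightarrow> reg s x = reg s y"

text \<open>
  \<open>exec W p s t s'\<close>: with word bound \<open>W\<close>, program \<open>p\<close> started in state \<open>s\<close> halts in
  state \<open>s'\<close> after exactly \<open>t\<close> steps.
\<close>

inductive exec :: "nat \<Rightarrow> prog \<Rightarrow> ram_state \<Rightarrow> nat \<Rightarrow> ram_state \<Rightarrow> bool" for W where
  Do: "instr_step W i s = Some s' \<Longrightarrow> exec W (Do i) s 1 s'"
| Seq: "exec W p s t s' \<Longrightarrow> exec W q s' t' s'' \<Longrightarrow> exec W (Seq p q) s (t + t') s''"
| CondTrue: "test_holds b s \<Longrightarrow> exec W p s t s' \<Longrightarrow> exec W (Cond b p q) s (Suc t) s'"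
| CondFalse: "\<not> test_holds b s \<Longrightarrow> exec W q s t s' \<Longrightarrow> exec W (Cond b p q) s (Suc t) s'"
| LoopFalse: "\<not> test_holds b s \<Longrightarrow> exec W (Loop b p) s 1 s"
| LoopTrue: "test_holds b s \<Longrightarrow> exec W p s t s' \<Longrightarrow> exec W (Loop b p) s' t' s'' \<Longrightarrow>
     exec W (Loop b p) s (Suc (t + t')) s''"

text \<open>
  The instances are the \<open>x\<close> for which \<open>Input x s\<close> is satisfiable; \<open>Input x s\<close> says that \<open>s\<close> is an
  initial state presenting the instance \<open>x\<close>, and \<open>Output x s'\<close> that the final state \<open>s'\<close> holds a
  correct answer. The word bound is polynomial in the instance size, i.e. words have
  logarithmically many bits. The program and the constants \<open>c\<close>, \<open>d\<close> do not depend on the instance.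
\<close>

definition solvable_in_linear_time ::
    "('a \<Rightarrow> nat) \<Rightarrow> ('a \<Rightarrow> ram_state \<Rightarrow> bool) \<Rightarrow> ('a \<Rightarrow> ram_state \<Rightarrow> bool) \<Rightarrow> bool" where
  "solvable_in_linear_time sz Input Output \<longleftrightarrow>
     (\<exists>p c d. \<forall>x s. Input x s \<longrightarrow>
        (\<exists>t s'. exec (d * sz x ^ d) p s t s' \<and> t \<le> c * sz x \<and> Output x s'))"

definition graph_size :: "('v, 'e) multigraph \<Rightarrow> nat" where
  "graph_size G = card (mverts G) + card (medges G)"

text \<open>
  Vertices are \<open>0,\<dots>,n-1\<close> and edges \<open>0,\<dots>,m-1\<close>. Registers 0 and 1 hold \<open>n\<close> and \<open>m\<close>; arrays 0
  and 1 hold the two ends of each edge, in arbitrary order; array 2 marks the edges of \<open>T\<close>, the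
  other edges being those of \<open>P\<close>. All other memory is 0.
\<close>

definition encodes ::
    "(nat, nat) multigraph \<Rightarrow> (nat, nat) multigraph \<Rightarrow> ram_state \<Rightarrow> bool" where
  "encodes G T s \<longleftrightarrow> (\<exists>n m.
     mverts G = {..<n} \<and> medges G = {..<m} \<and>
     reg s = (\<lambda>_. 0)(0 := n, 1 := m) \<and>
     (\<forall>e<m. ends G e = {arr s 0 e, arr s 1 e} \<and> arr s 2 e = (if e \<in> medges T then 1 else 0)) \<and>
     (\<forall>a i. a > 2 \<or> i \<ge> m \<longrightarrow> arr s a i = 0))"

text \<open>The answer is read off arrays 3 (tails) and 4 (heads).\<close>

definition decoded_digraph :: "(nat, nat) multigraph \<Rightarrow> ram_state \<Rightarrow> (nat, nat) pre_digraph" where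
  "decoded_digraph G s =
     \<lparr>verts = mverts G, arcs = medges G, tail = arr s 3, head = arr s 4\<rparr>"

end

(*
  Two-colour T and let the pseudoforest P assign to each of its edges an owner, one of its ends, so
  that distinct edges have distinct owners. Orient every edge of T from black to white, every edge
  of P joining different colours from white to black, and every edge of P joining equal colours so
  that it enters its owner if the owner is black and leaves it if the owner is white.

  On a closed antidirected trail every arc shares its tail with another arc of the trail, and
  likewise its head. Every edge of P enters a black owner and leaves a white one, which no edge of
  T does; so from an edge of P on the trail one gets another edge of P that joins different colours
  and whose non-owner end is the owner of the first. Iterating gives a cycle of P along which the
  colours alternate, hence an even cycle. If the trail lies within T, the leaf of a subforest of T
  gives the contradiction.

  In linear time: keep for each vertex its degree and the sum of the names of its remaining edges.
  At a leaf the sum is the remaining edge, so leaves can be stripped without adjacency lists, each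
  leaf becoming the owner of its edge. For T, colouring in the reverse order is proper. For P, a
  count of edges against owners shows that all remaining degrees are 0 or 2, and removing one
  edge of each cycle lets the stripping continue.
*)

theory Submission
  imports Defs
begin

section \<open>Walks, leaves and cycles\<close>

text \<open>The hypothesis on P enters in two places only: at most one cycle per component yields
  the owner map, and oddness contradicts the even cycle at the very end. The program never
  recognises a cycle or a component. Its correctness proof uses the mere existence of some owner
  map: distinct owners bound the number of remaining edges by the number of vertices they touch,
  which forces the degrees once no leaf is left. The owner map that the program itself finds may be
  a different one. Stripping is amortised. Removing a leaf can create a new leaf only at its
  neighbour, so following that neighbour makes a single scan of the vertices sufficient, and the
  work along the way is charged to the removed edges. The sums of edge names can be quadratic in the
  number of edges, which dictates the word bound. Once T is stripped completely, all degrees and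
  sums are 0 again, so the same arrays serve P without being cleared.\<close>

lemma walk_Nil: "walk G vs [] \<longleftrightarrow> (\<exists>v\<in>mverts G. vs = [v])"
  unfolding walk_def by (cases vs) auto

lemma walk_Cons:
  "walk G (v # vs) (e # es) \<longleftrightarrow>
     v \<in> mverts G \<and> e \<in> medges G \<and> ends G e = {v, hd vs} \<and> walk G vs es"
proof (cases vs)
  case (Cons a as)
  then show ?thesis
    unfolding walk_def by (auto simp: All_less_Suc2)
qed (auto simp: walk_def)

lemma walk_ConsE:
  assumes "walk G vs (e # es)"
  obtains v vs' where "vs = v # vs'" "vs' \<noteq> []" "v \<in> mverts G" "e \<in> medges G"
    "ends G e = {v, hd vs'}" "walk G vs' es"
proof (cases vs)
  case Nil
  with assms show ?thesis by (simp add: walk_def)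
next
  case (Cons v vs')
  moreover from this assms have "vs' \<noteq> []" by (auto simp: walk_def)
  ultimately show ?thesis using assms that by (auto simp: walk_Cons)
qed

lemma walk_not_Nil: "walk G vs es \<Longrightarrow> vs \<noteq> []"
  by (auto simp: walk_def)

lemma walk_append:
  assumes "walk G vs es" "walk G ws fs" "last vs = hd ws"
  shows "walk G (vs @ tl ws) (es @ fs)"
  using assms
proof (induction es arbitrary: vs)
  case Nil
  then obtain v where "vs = [v]" by (auto simp: walk_Nil)
  with Nil show ?case by (cases ws) (auto dest: walk_not_Nil)
next
  case (Cons e es)
  from Cons.prems(1) obtain v vs' where v: "vs = v # vs'" "vs' \<noteq> []" "v \<in> mverts G" "e \<in> medges G"
    "ends G e = {v, hd vs'}" "walk G vs' es" by (rule walk_ConsE)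
  with Cons.IH[OF v(6)] Cons.prems show ?case by (auto simp: walk_Cons)
qed

lemma walk_rev:
  assumes "walk G vs es"
  shows "walk G (rev vs) (rev es)"
  using assms
proof (induction es arbitrary: vs)
  case Nil
  then show ?case by (force simp: walk_Nil)
next
  case (Cons e es)
  from Cons.prems obtain v vs' where v: "vs = v # vs'" "vs' \<noteq> []" "v \<in> mverts G" "e \<in> medges G"
    "ends G e = {v, hd vs'}" "walk G vs' es" by (rule walk_ConsE)
  have "hd vs' \<in> mverts G" using v unfolding walk_def by (cases vs') auto
  then have "walk G [hd vs', v] [e]" using v by (auto simp: walk_Cons walk_Nil)
  from walk_append[OF Cons.IH[OF v(6)] this] v show ?case by (simp add: last_rev)
qed

lemma walk_take:
  assumes "walk G vs es" "i \<le> length es"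
  shows "walk G (take (Suc i) vs) (take i es)"
  using assms unfolding walk_def by (auto dest: in_set_takeD)

lemma walk_mono:
  assumes "walk H vs es" "mverts H \<subseteq> mverts G" "medges H \<subseteq> medges G"
    "\<And>e. e \<in> medges H \<Longrightarrow> ends H e = ends G e"
  shows "walk G vs es"
  using assms unfolding walk_def by (auto simp: subset_iff)

lemma reachable_in_mono:
  assumes "reachable_in H u v" "mverts H \<subseteq> mverts G" "medges H \<subseteq> medges G"
    "\<And>e. e \<in> medges H \<Longrightarrow> ends H e = ends G e"
  shows "reachable_in G u v"
  using assms walk_mono unfolding reachable_in_def by metis

lemma cycle_edges_mono:
  assumes "cycle_edges H C" "mverts H \<subseteq> mverts G" "medges H \<subseteq> medges G"
    "\<And>e. e \<in> medges H \<Longrightarrow> ends H e = ends G e"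
  shows "cycle_edges G C"
proof -
  from assms(1) obtain vs es where "walk H vs es" "length es \<ge> 2" "hd vs = last vs"
    "distinct (tl vs)" "distinct es" "C = set es" unfolding cycle_edges_def by blast
  moreover from this(1) assms(2-4) have "walk G vs es" by (rule walk_mono)
  ultimately show ?thesis unfolding cycle_edges_def by blast
qed

lemma reachable_in_trans:
  assumes "reachable_in G u v" "reachable_in G v w"
  shows "reachable_in G u w"
proof -
  from assms obtain vs es ws fs where w: "walk G vs es" "hd vs = u" "last vs = v"
    "walk G ws fs" "hd ws = v" "last ws = w" unfolding reachable_in_def by blast
  from w have "walk G (vs @ tl ws) (es @ fs)" by (intro walk_append) auto
  moreover have "hd (vs @ tl ws) = u" using w by (auto dest: walk_not_Nil)
  moreover have "last (vs @ tl ws) = w"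
  proof (cases ws)
    case (Cons x xs)
    then show ?thesis using w by (cases xs) auto
  qed (use w in \<open>auto dest: walk_not_Nil\<close>)
  ultimately show ?thesis unfolding reachable_in_def by blast
qed

lemma reachable_in_sym:
  assumes "reachable_in G u v"
  shows "reachable_in G v u"
proof -
  from assms obtain vs es where "walk G vs es" "hd vs = u" "last vs = v"
    unfolding reachable_in_def by blast
  then show ?thesis unfolding reachable_in_def
    by (intro exI[of _ "rev vs"] exI[of _ "rev es"]) (auto simp: walk_rev hd_rev last_rev)
qed

lemma reachable_in_walk_hd:
  assumes "walk G vs es" "v \<in> set vs"
  shows "reachable_in G (hd vs) v"
proof -
  from assms obtain i where i: "i < length vs" "v = vs ! i" by (auto simp: in_set_conv_nth)
  with assms have "walk G (take (Suc i) vs) (take i es)" by (intro walk_take) (auto simp: walk_def)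
  moreover have "last (take (Suc i) vs) = v" using i by (simp add: take_Suc_conv_app_nth)
  moreover have "hd (take (Suc i) vs) = hd vs" using i by (cases vs) auto
  ultimately show ?thesis unfolding reachable_in_def by blast
qed

text \<open>The ends function and the edge set are separate arguments, so that the same notion
  serves edge subsets of a multigraph and the two arrays of ends that the program reads.\<close>

definition edges_at :: "('e \<Rightarrow> 'v set) \<Rightarrow> 'e set \<Rightarrow> 'v \<Rightarrow> 'e set" where
  "edges_at \<epsilon> A v = {e \<in> A. v \<in> \<epsilon> e}"

text \<open>A second edge at the end \<open>v\<close> of a longest path leads either to a new
  vertex, which prolongs the path, or back to the path, which closes a cycle. A parallel edge is the
  case of a cycle of length 2.\<close>

lemma longest_path_start:
  assumes G: "finite_loopless G"
    and w: "walk G (v # vs) (e # es)" and d: "distinct (v # vs)"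
    and max: "\<And>vs' es'. walk G vs' es' \<Longrightarrow> distinct vs' \<Longrightarrow> length vs' \<le> length (v # vs)"
    and nc: "\<nexists>C. cycle_edges G C"
  shows "edges_at (ends G) (medges G) v = {e}"
proof -
  have "f = e" if f: "f \<in> medges G" "v \<in> ends G f" for f
  proof (rule ccontr)
    assume fe: "f \<noteq> e"
    have "card (ends G f) = 2" "ends G f \<subseteq> mverts G" using G f by (auto simp: finite_loopless_def)
    with f obtain c where c: "ends G f = {v, c}" "c \<noteq> v" "c \<in> mverts G"
      by (auto simp: card_2_iff doubleton_eq_iff)
    show False
    proof (cases "c \<in> set vs")
      case False
      have "walk G (c # v # vs) (f # e # es)"
        using w c f by (subst walk_Cons) (auto simp: insert_commute)
      moreover have "distinct (c # v # vs)" using False d c by auto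
      ultimately show False using max by fastforce
    next
      case True
      then obtain i where i: "i < length vs" "c = vs ! i" by (auto simp: in_set_conv_nth)
      have l: "length vs = Suc (length es)" using w by (auto simp: walk_def)
      \<comment> \<open>\<open>c\<close> is entry \<open>Suc i\<close> of \<open>v # vs\<close>, so
        the segment from \<open>v\<close> to \<open>c\<close> has \<open>Suc (Suc i)\<close>
        vertices and \<open>Suc i\<close> edges; putting \<open>c\<close> and \<open>f\<close> in
        front closes it.\<close>
      let ?vs = "take (Suc (Suc i)) (v # vs)" and ?es = "take (Suc i) (e # es)"
      have "walk G ?vs ?es" using w i l by (intro walk_take) auto
      then have W: "walk G (c # ?vs) (f # ?es)"
        using f c by (subst walk_Cons) (auto simp: insert_commute)
      \<comment> \<open>The edges in \<open>es\<close> have both ends in \<open>vs\<close>, which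
        misses \<open>v\<close>.\<close>
      have fn: "f \<notin> set es"
      proof
        assume "f \<in> set es"
        then obtain j where "j < length es" "f = es ! j" by (auto simp: in_set_conv_nth)
        with w have "ends G f = {vs ! j, vs ! Suc j}" "{vs ! j, vs ! Suc j} \<subseteq> set vs"
          using l by (auto simp: walk_Cons walk_def)
        with c d show False by auto
      qed
      have de: "distinct es'" if "walk G vs' es'" "distinct vs'" for vs' es'
        using that
      proof (induction es' arbitrary: vs')
        case (Cons a es'')
        from Cons.prems(1) obtain x xs where x: "vs' = x # xs" "xs \<noteq> []" "ends G a = {x, hd xs}"
          "walk G xs es''" by (rule walk_ConsE)
        have "a \<notin> set es''"
        proof
          assume "a \<in> set es''"
          then obtain j where "j < length es''" "a = es'' ! j" by (auto simp: in_set_conv_nth)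
          with x have "x \<in> set xs" by (auto simp: walk_def doubleton_eq_iff)
          with Cons.prems x show False by auto
        qed
        with Cons x show ?case by auto
      qed simp
      have "distinct (f # ?es)"
        using de[OF w d] fn fe by (auto dest: in_set_takeD)
      moreover have "hd (c # ?vs) = last (c # ?vs)"
        using i by (simp add: take_Suc_conv_app_nth)
      moreover have "distinct (tl (c # ?vs))" using d by (simp only: list.sel distinct_take)
      moreover have "length (f # ?es) \<ge> 2" by simp
      ultimately have "cycle_edges G (set (f # ?es))" using W unfolding cycle_edges_def by blast
      with nc show False by blast
    qed
  qed
  moreover have "e \<in> medges G" "v \<in> ends G e" using w by (auto simp: walk_Cons)
  ultimately show ?thesis unfolding edges_at_def by blast
qed

text \<open>Both ends of a longest path are leaves. They come as a connected pair because a set with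
  at most one vertex per component must then miss one of them; the choice of owners relies on
  this.\<close>

lemma acyclic_two_leaves:
  assumes G: "finite_loopless G" and ne: "medges G \<noteq> {}" and nc: "\<nexists>C. cycle_edges G C"
  obtains a b e f where "a \<noteq> b" "reachable_in G a b"
    "edges_at (ends G) (medges G) a = {e}" "edges_at (ends G) (medges G) b = {f}"
proof -
  define Q where "Q = (\<lambda>(vs, es). walk G vs es \<and> distinct vs)"
  from ne obtain e where e: "e \<in> medges G" by blast
  with G obtain x y where "ends G e = {x, y}" "x \<noteq> y" "x \<in> mverts G" "y \<in> mverts G"
    by (force simp: finite_loopless_def card_2_iff)
  with e have Q0: "Q ([x, y], [e])" by (auto simp: Q_def walk_Cons walk_Nil)
  have bd: "\<forall>p. Q p \<longrightarrow> length (fst p) < Suc (card (mverts G))"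
  proof (intro allI impI)
    fix p assume "Q p"
    then have "card (set (fst p)) = length (fst p)" "set (fst p) \<subseteq> mverts G"
      by (auto simp: Q_def walk_def distinct_card)
    then show "length (fst p) < Suc (card (mverts G))"
      using G card_mono[of "mverts G" "set (fst p)"] by (auto simp: finite_loopless_def)
  qed
  obtain p where p: "Q p" "\<And>p'. Q p' \<Longrightarrow> length (fst p') \<le> length (fst p)"
    using ex_has_greatest_nat[where P = Q and f = "\<lambda>p. length (fst p)", OF Q0 bd] by blast
  obtain vs es where [simp]: "p = (vs, es)" by (cases p)
  have q: "Q (vs, es)" and m: "\<And>p. Q p \<Longrightarrow> length (fst p) \<le> length vs"
    using p by auto
  have max: "length vs' \<le> length vs" if "walk G vs' es'" "distinct vs'" for vs' es'
    using m[of "(vs', es')"] that by (auto simp: Q_def)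
  have w: "walk G vs es" "distinct vs" using q by (auto simp: Q_def)
  have "2 \<le> length vs" using m[OF Q0] by simp
  then obtain e1 es1 where e1: "es = e1 # es1" using w by (cases es) (auto simp: walk_def)
  then obtain v vs1 where v: "vs = v # vs1" "vs1 \<noteq> []" using w by (auto elim: walk_ConsE)
  have 1: "edges_at (ends G) (medges G) (hd vs) = {e1}"
    using longest_path_start[OF G _ _ _ nc, of v vs1 e1 es1] w e1 v max by auto
  obtain e2 es2 where e2: "rev es = e2 # es2" using e1 by (cases "rev es") auto
  obtain u vs2 where u: "rev vs = u # vs2" using v by (cases "rev vs") auto
  have "walk G (u # vs2) (e2 # es2)" using walk_rev[OF w(1)] e2 u by simp
  moreover have "distinct (u # vs2)" using w u distinct_rev by metis
  moreover have "length (u # vs2) = length vs" using u length_rev by metis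
  ultimately have 2: "edges_at (ends G) (medges G) (hd (rev vs)) = {e2}"
    using longest_path_start[OF G _ _ _ nc, of u vs2 e2 es2] max u by auto
  have "hd vs \<noteq> last vs" using v w by auto
  moreover have "reachable_in G (hd vs) (last vs)" using w unfolding reachable_in_def by blast
  ultimately show ?thesis using that 1 2 by (simp add: hd_rev)
qed

lemma walk_ends_subset:
  assumes "walk G vs es" "e \<in> set es"
  shows "ends G e \<subseteq> set vs"
proof -
  from assms obtain i where "i < length es" "e = es ! i" by (auto simp: in_set_conv_nth)
  with assms(1) have "ends G e = {vs ! i, vs ! Suc i}" "i < length vs" "Suc i < length vs"
    by (auto simp: walk_def)
  then show ?thesis by simp
qed

lemma reachable_in_refl: "v \<in> mverts G \<Longrightarrow> reachable_in G v v"
  unfolding reachable_in_def by (intro exI[of _ "[v]"] exI[of _ "[]"]) (auto simp: walk_Nil)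

lemma cycle_in_component:
  assumes "cycle_edges G C" "e \<in> C" "x \<in> ends G e" "reachable_in G z x"
  shows "cycle_edges (component_of G z) C"
proof -
  from assms(1) obtain vs es where w: "walk G vs es" "length es \<ge> 2" "hd vs = last vs"
    "distinct (tl vs)" "distinct es" "C = set es" unfolding cycle_edges_def by blast
  have "x \<in> set vs" using walk_ends_subset[OF w(1)] assms w by blast
  then have "reachable_in G z (hd vs)"
    using reachable_in_walk_hd[OF w(1)] reachable_in_sym reachable_in_trans assms(4) by metis
  then have r: "reachable_in G z v" if "v \<in> set vs" for v
    using reachable_in_walk_hd[OF w(1) that] reachable_in_trans by metis
  have "walk (component_of G z) vs es"
    using w(1) r walk_ends_subset[OF w(1)]
    unfolding component_of_def walk_def Let_def by (simp add: subset_iff)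
  with w show ?thesis unfolding cycle_edges_def by blast
qed

lemma cycle_edges_subset: "cycle_edges G C \<Longrightarrow> C \<subseteq> medges G"
  unfolding cycle_edges_def walk_def by auto

text \<open>Replaces the component records in \<open>pseudoforest\<close> by reachability between
  two vertices on the cycles, the form in which representatives of cycles are compared.\<close>

lemma pseudoforest_unique_cycle:
  assumes P: "pseudoforest G" and C: "cycle_edges G C" "e \<in> C" "x \<in> ends G e"
    and C': "cycle_edges G C'" "e' \<in> C'" "x' \<in> ends G e'"
    and r: "reachable_in G x x'"
  shows "C = C'"
proof -
  have "x \<in> mverts G"
    using P C cycle_edges_subset unfolding pseudoforest_def finite_loopless_def by blast
  then have "component_of G x \<in> components G" "reachable_in G x x"
    by (auto simp: components_def reachable_in_refl)
  with P cycle_in_component[OF C] cycle_in_component[OF C' r] show ?thesis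
    unfolding pseudoforest_def by blast
qed

section \<open>Owner maps and proper colourings by removal of leaves\<close>

lemma finite_loopless_edges_update:
  assumes "finite_loopless G" "A \<subseteq> medges G"
  shows "finite_loopless (G\<lparr>medges := A\<rparr>)"
  using assms finite_subset unfolding finite_loopless_def by auto

lemma acyclic_edges_update:
  assumes "\<nexists>C. cycle_edges G C" "A \<subseteq> medges G"
  shows "\<nexists>C. cycle_edges (G\<lparr>medges := A\<rparr>) C"
  using assms cycle_edges_mono[of "G\<lparr>medges := A\<rparr>" _ G] by auto

text \<open>Remove a leaf outside \<open>Z\<close> and let it own its edge: no remaining edge
  contains it, so no other owner repeats it. Of two connected leaves at most one lies in
  \<open>Z\<close>, and deleting edges only shrinks reachability, so the hypothesis on
  \<open>Z\<close> survives. \<open>Z\<close> stands for vertices already reserved as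
  owners.\<close>

lemma forest_owner:
  assumes "finite_loopless F" "\<nexists>C. cycle_edges F C"
    and "\<And>a b. a \<in> Z \<Longrightarrow> b \<in> Z \<Longrightarrow> reachable_in F a b \<Longrightarrow> a = b"
  shows "\<exists>own. inj_on own (medges F) \<and> (\<forall>e\<in>medges F. own e \<in> ends F e - Z)"
  using assms
proof (induction "card (medges F)" arbitrary: F)
  case 0
  then have "medges F = {}" by (auto simp: finite_loopless_def)
  then show ?case by auto
next
  case (Suc k)
  then have "medges F \<noteq> {}" by auto
  from acyclic_two_leaves[OF Suc.prems(1) this Suc.prems(2)] Suc.prems(3)
  obtain v e where v: "v \<notin> Z" "edges_at (ends F) (medges F) v = {e}" by metis
  let ?F = "F\<lparr>medges := medges F - {e}\<rparr>"
  have e: "e \<in> medges F" "v \<in> ends F e" using v unfolding edges_at_def by blast+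
  have "k = card (medges ?F)" using Suc.hyps(2) e by simp
  moreover have "finite_loopless ?F" by (rule finite_loopless_edges_update) (use Suc.prems in auto)
  moreover have "\<nexists>C. cycle_edges ?F C" by (rule acyclic_edges_update) (use Suc.prems in auto)
  moreover have "a = b" if "a \<in> Z" "b \<in> Z" "reachable_in ?F a b" for a b
    by (rule Suc.prems(3)[OF that(1,2) reachable_in_mono[OF that(3)]]) auto
  ultimately obtain own where own: "inj_on own (medges ?F)" "\<forall>e\<in>medges ?F. own e \<in> ends ?F e - Z"
    using Suc.hyps(1)[of ?F] by blast
  have "v \<notin> own ` (medges F - {e})" using own(2) v(2) unfolding edges_at_def by auto
  then have "inj_on (own(e := v)) (medges F)"
    using own(1) e by (auto simp: inj_on_def)
  moreover have "\<forall>f\<in>medges F. (own(e := v)) f \<in> ends F f - Z" using own(2) v(1) e by auto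
  ultimately show ?case by blast
qed

text \<open>Induction on the edges: a leaf can be recoloured against its neighbour without affecting
  any other edge.\<close>

lemma forest_colouring:
  assumes "finite_loopless F" "\<nexists>C. cycle_edges F C"
  shows "\<exists>col. \<forall>e\<in>medges F. \<exists>x y. ends F e = {x, y} \<and> col x \<and> \<not> col y"
  using assms
proof (induction "card (medges F)" arbitrary: F)
  case 0
  then have "medges F = {}" by (auto simp: finite_loopless_def)
  then show ?case by auto
next
  case (Suc k)
  then have "medges F \<noteq> {}" by auto
  from acyclic_two_leaves[OF Suc.prems(1) this Suc.prems(2)]
  obtain v e where v: "edges_at (ends F) (medges F) v = {e}" by metis
  let ?F = "F\<lparr>medges := medges F - {e}\<rparr>"
  have e: "e \<in> medges F" "v \<in> ends F e" using v unfolding edges_at_def by blast+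
  then obtain w where w: "ends F e = {v, w}" "w \<noteq> v"
    using Suc.prems(1) by (force simp: finite_loopless_def card_2_iff)
  have "k = card (medges ?F)" using Suc.hyps(2) e by simp
  moreover have "finite_loopless ?F" by (rule finite_loopless_edges_update) (use Suc.prems in auto)
  moreover have "\<nexists>C. cycle_edges ?F C" by (rule acyclic_edges_update) (use Suc.prems in auto)
  ultimately obtain col where col: "\<forall>e\<in>medges ?F. \<exists>x y. ends ?F e = {x, y} \<and> col x \<and> \<not> col y"
    using Suc.hyps(1)[of ?F] by blast
  have "\<exists>x y. ends F f = {x, y} \<and> (col(v := \<not> col w)) x \<and> \<not> (col(v := \<not> col w)) y"
    if f: "f \<in> medges F" for f
  proof (cases "f = e")
    case True
    show ?thesis
    proof (cases "col w")
      case True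
      then show ?thesis using w \<open>f = e\<close> by (intro exI[of _ w] exI[of _ v]) auto
    next
      case False
      then show ?thesis using w \<open>f = e\<close> by (intro exI[of _ v] exI[of _ w]) auto
    qed
  next
    case False
    then have "v \<notin> ends F f" using v f unfolding edges_at_def by blast
    moreover obtain x y where "ends F f = {x, y}" "col x" "\<not> col y"
      using bspec[OF col, of f] f False by auto
    ultimately have "v \<noteq> x" "v \<noteq> y" "ends F f = {x, y}" "col x" "\<not> col y" by auto
    then show ?thesis by (intro exI[of _ x] exI[of _ y]) simp
  qed
  then show ?case by (intro exI[of _ "col(v := \<not> col w)"]) blast
qed

text \<open>
  Delete one edge of each cycle and let it be owned by one of its ends. These ends lie in distinct
  components, so the remaining forest can be stripped of its leaves without touching them.
\<close>

lemma pseudoforest_owner: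
  assumes P: "pseudoforest P"
  shows "\<exists>own. inj_on own (medges P) \<and> (\<forall>e\<in>medges P. own e \<in> ends P e)"
proof -
  have fl: "finite_loopless P" using P by (simp add: pseudoforest_def)
  define r where "r C = (SOME e. e \<in> C)" for C :: "'b set"
  have r: "r C \<in> C" if "cycle_edges P C" for C
  proof -
    have "C \<noteq> {}" using that unfolding cycle_edges_def by auto
    then show ?thesis unfolding r_def by (simp add: some_in_eq)
  qed
  define R where "R = r ` {C. cycle_edges P C}"
  have RP: "R \<subseteq> medges P" using r cycle_edges_subset unfolding R_def by blast
  define z where "z e = (SOME x. x \<in> ends P e)" for e
  have z: "z e \<in> ends P e" if "e \<in> medges P" for e
  proof -
    have "ends P e \<noteq> {}" using that fl by (auto simp: finite_loopless_def)
    then show ?thesis unfolding z_def by (simp add: some_in_eq)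
  qed
  \<comment> \<open>Used twice: it shows that the chosen ends meet each component at most once, as
    \<open>forest_owner\<close> demands, and, with trivial reachability, that \<open>z\<close> is
    injective on \<open>R\<close>.\<close>
  have Z: "e = e'" if "e \<in> R" "e' \<in> R" "reachable_in P (z e) (z e')" for e e'
  proof -
    from that obtain C C' where C: "cycle_edges P C" "e = r C" "cycle_edges P C'" "e' = r C'"
      unfolding R_def by blast
    have "C = C'"
      by (rule pseudoforest_unique_cycle[OF P C(1) _ _ C(3) _ _ that(3)])
         (use C r z RP that in auto)
    with C show ?thesis by simp
  qed
  let ?F = "P\<lparr>medges := medges P - R\<rparr>"
  have "finite_loopless ?F" using fl by (rule finite_loopless_edges_update) auto
  moreover have "\<nexists>C. cycle_edges ?F C"
  proof
    assume "\<exists>C. cycle_edges ?F C"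
    then obtain C where C: "cycle_edges ?F C" by blast
    then have "cycle_edges P C" by (rule cycle_edges_mono) auto
    then have "r C \<in> C" "r C \<in> R" using r by (auto simp: R_def)
    with cycle_edges_subset[OF C] show False by auto
  qed
  moreover have "a = b" if ab: "a \<in> z ` R" "b \<in> z ` R" "reachable_in ?F a b" for a b
  proof -
    have "reachable_in P a b" using ab(3) by (rule reachable_in_mono) auto
    with ab Z show ?thesis by blast
  qed
  ultimately obtain own where own: "inj_on own (medges ?F)"
    "\<forall>e\<in>medges ?F. own e \<in> ends ?F e - z ` R"
    using forest_owner[of ?F "z ` R"] by blast
  let ?own = "\<lambda>e. if e \<in> R then z e else own e"
  have "e = e'" if "e \<in> R" "e' \<in> R" "z e = z e'" for e e'
  proof (rule Z[OF that(1,2)])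
    have "z e \<in> mverts P" using z that RP fl unfolding finite_loopless_def by blast
    then show "reachable_in P (z e) (z e')" using that reachable_in_refl by metis
  qed
  then have "inj_on ?own (medges P)"
    using own unfolding inj_on_def by (auto split: if_splits) (metis DiffI imageI)+
  moreover have "\<forall>e\<in>medges P. ?own e \<in> ends P e" using own(2) z by auto
  ultimately show ?thesis by blast
qed

text \<open>Double counting. The degrees sum to \<open>2 * card A\<close>, while \<open>own\<close>
  embeds \<open>A\<close> into the set \<open>X\<close> of touched vertices. If all degrees on
  \<open>X\<close> are at least 2 and one is larger, then \<open>card X < card A\<close>, a
  contradiction.\<close>

lemma owned_degrees_zero_or_two:
  assumes fin: "finite A" and card2: "\<And>e. e \<in> A \<Longrightarrow> card (\<epsilon> e) = 2"
    and own: "inj_on own A" "\<And>e. e \<in> A \<Longrightarrow> own e \<in> \<epsilon> e"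
    and n1: "\<And>v. card (edges_at \<epsilon> A v) \<noteq> 1"
  shows "card (edges_at \<epsilon> A v) \<in> {0, 2}"
proof (rule ccontr)
  assume v: "card (edges_at \<epsilon> A v) \<notin> {0, 2}"
  define X where "X = (\<Union>e\<in>A. \<epsilon> e)"
  have finX: "finite X" unfolding X_def using fin card2 by (auto intro!: card_ge_0_finite)
  have fe: "finite (edges_at \<epsilon> A u)" for u using fin by (simp add: edges_at_def)
  have ge2: "2 \<le> card (edges_at \<epsilon> A u)" if "u \<in> X" for u
  proof -
    have "edges_at \<epsilon> A u \<noteq> {}" using that by (auto simp: X_def edges_at_def)
    then have "card (edges_at \<epsilon> A u) \<noteq> 0" using fe by simp
    with n1[of u] show ?thesis by linarith
  qed
  have "edges_at \<epsilon> A v \<noteq> {}" using v by auto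
  then have vX: "v \<in> X" by (auto simp: X_def edges_at_def)
  have "2 * card A = (\<Sum>e\<in>A. card (\<epsilon> e))" using card2 by simp
  also have "\<dots> = (\<Sum>e\<in>A. \<Sum>u\<in>X. if u \<in> \<epsilon> e then 1 else 0)"
  proof (rule sum.cong)
    fix e assume "e \<in> A"
    then have "X \<inter> \<epsilon> e = \<epsilon> e" by (auto simp: X_def)
    moreover have "(\<Sum>u\<in>X. if u \<in> \<epsilon> e then 1 else 0) = card (X \<inter> \<epsilon> e)"
      using finX by (simp add: sum.If_cases Int_def)
    ultimately show "card (\<epsilon> e) = (\<Sum>u\<in>X. if u \<in> \<epsilon> e then 1 else 0)" by simp
  qed simp
  also have "\<dots> = (\<Sum>u\<in>X. \<Sum>e\<in>A. if u \<in> \<epsilon> e then 1 else 0)" by (rule sum.swap)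
  also have "\<dots> = (\<Sum>u\<in>X. card (edges_at \<epsilon> A u))"
    using fin by (simp add: sum.If_cases Int_def edges_at_def)
  also have "\<dots> > (\<Sum>u\<in>X. 2)"
    using v ge2 vX by (intro sum_strict_mono_ex1 finX) (auto intro!: bexI[of _ v] le_neq_implies_less)
  finally have "card X < card A" by simp
  moreover have "card A \<le> card X"
    using own finX by (intro card_inj_on_le[of own]) (auto simp: X_def)
  ultimately show False by simp
qed

section \<open>The orientation given by a colouring and an owner map\<close>

text \<open>The pigeonhole principle gives a periodic point; a point whose period is least among all
  points of \<open>U\<close> has an orbit without repetition.\<close>

lemma ex_minimal_period:
  assumes "finite U" "U \<noteq> {}" "h ` U \<subseteq> U"
  obtains x k where "x \<in> U" "k > 0" "(h ^^ k) x = x" "inj_on (\<lambda>i. (h ^^ i) x) {..<k}"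
    "\<And>i. (h ^^ i) x \<in> U"
proof -
  have U: "(h ^^ i) x \<in> U" if "x \<in> U" for i x using that assms(3) by (induction i) auto
  \<comment> \<open>The period may belong to any point of \<open>U\<close>: a coincidence at steps
    \<open>i < j\<close> is a period of the shifted point \<open>(h ^^ i) x\<close>, and minimality
    must apply to that point too.\<close>
  define per where "per k \<longleftrightarrow> k > 0 \<and> (\<exists>x\<in>U. (h ^^ k) x = x)" for k
  from assms obtain x0 where x0: "x0 \<in> U" by blast
  have "\<not> inj (\<lambda>i. (h ^^ i) x0)"
    using assms(1) U[OF x0] finite_subset[of "range (\<lambda>i. (h ^^ i) x0)" U]
      finite_imageD[of "\<lambda>i. (h ^^ i) x0" UNIV] by auto
  then obtain i j where ij: "i < j" "(h ^^ i) x0 = (h ^^ j) x0"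
    unfolding inj_def by (metis linorder_neq_iff)
  have shift: "(h ^^ (j - i)) ((h ^^ i) x) = (h ^^ j) x" if "i \<le> j" for i j x
    using funpow_add[of "j - i" i h] that by (metis comp_apply le_add_diff_inverse2)
  have "(h ^^ (j - i)) ((h ^^ i) x0) = (h ^^ i) x0"
    using ij shift[of i j x0] by simp
  with ij U[OF x0] have ex: "per (j - i)" unfolding per_def by auto
  define k where "k = (LEAST k. per k)"
  from ex have "per k" unfolding k_def by (rule LeastI)
  then obtain x where x: "x \<in> U" "(h ^^ k) x = x" "k > 0" unfolding per_def by blast
  have "i = j" if "i \<le> j" "j < k" "(h ^^ i) x = (h ^^ j) x" for i j
  proof (rule ccontr)
    assume "i \<noteq> j"
    have "(h ^^ (j - i)) ((h ^^ i) x) = (h ^^ i) x"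
      using that shift[of i j x] by simp
    then have "per (j - i)" using that \<open>i \<noteq> j\<close> U[OF x(1)] unfolding per_def by auto
    then have "k \<le> j - i" unfolding k_def by (rule Least_le)
    with that x show False by simp
  qed
  then have "inj_on (\<lambda>i. (h ^^ i) x) {..<k}"
    unfolding inj_on_def by (metis lessThan_iff nat_le_linear)
  with x U that show ?thesis by blast
qed

text \<open>Consecutive arcs of the trail, taken cyclically, either share their heads or share their
  tails, and of the two neighbours of an arc one does the former and the other the latter. In a
  trail of length 2 both neighbours are the same parallel arc.\<close>

lemma closed_antidirected_trail_partners:
  assumes tr: "closed_antidirected_trail D vs es"
    and loopless: "\<And>e. e \<in> arcs D \<Longrightarrow> tail D e \<noteq> head D e"
    and e: "e \<in> set es"
  shows "\<exists>f\<in>set es. f \<noteq> e \<and> tail D f = tail D e"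
    and "\<exists>f\<in>set es. f \<noteq> e \<and> head D f = head D e"
proof -
  let ?L = "length es" and ?f = "forward_step D vs es" and ?b = "backward_step D vs es"
  have w: "walk (underlying D) vs es" and L: "even ?L" "es \<noteq> []" and cl: "hd vs = last vs"
    and d: "distinct es"
    and alt: "\<And>i. Suc i < ?L \<Longrightarrow> ?f i \<and> ?b (Suc i) \<or> ?b i \<and> ?f (Suc i)"
    using tr unfolding closed_antidirected_trail_def by blast+
  have lv: "length vs = Suc ?L" and arcs: "set es \<subseteq> arcs D"
    using w by (auto simp: walk_def underlying_def)
  have L2: "2 \<le> ?L" using L by (cases es rule: remdups_adj.cases) auto
  have fb: "\<not> (?f i \<and> ?b i)" if "i < ?L" for i
    using loopless[of "es ! i"] subsetD[OF arcs nth_mem[OF that]]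
    unfolding forward_step_def backward_step_def by auto
  \<comment> \<open>The direction of an arc depends only on the parity of its position, given the
    direction at position 0. Looplessness makes the two directions exclusive.\<close>
  have par: "if ?f 0 = even i then ?f i else ?b i" if "i < ?L" for i
    using that
  proof (induction i)
    case 0
    then show ?case using alt[of 0] L2 fb by auto
  next
    case (Suc i)
    then show ?case using alt[of i] fb[of i] fb[of "Suc i"] by (auto split: if_splits)
  qed
  from e obtain i where i: "i < ?L" "e = es ! i" by (auto simp: in_set_conv_nth)
  have wrap: "vs ! ?L = vs ! 0"
    using cl lv by (metis diff_Suc_1 hd_conv_nth last_conv_nth list.size(3) nat.distinct(1))
  \<comment> \<open>Even length makes the parity change also between the last position and the
    first.\<close>
  have next_ex: "\<exists>j<?L. j \<noteq> i \<and> (even j \<longleftrightarrow> odd i) \<and> vs ! Suc i = vs ! j"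
  proof (cases "Suc i = ?L")
    case True
    then have "odd i" using L(1) by (metis even_Suc)
    moreover have "i \<noteq> 0" using True L2 by auto
    ultimately show ?thesis using True wrap L2 by (intro exI[of _ 0]) auto
  next
    case False
    with i show ?thesis by (intro exI[of _ "Suc i"]) auto
  qed
  have prev_ex: "\<exists>j<?L. j \<noteq> i \<and> (even j \<longleftrightarrow> odd i) \<and> vs ! Suc j = vs ! i"
  proof (cases i)
    case 0
    then show ?thesis using L2 L(1) wrap by (intro exI[of _ "?L - 1"]) (auto simp: even_diff_nat)
  next
    case (Suc k)
    with i show ?thesis by (intro exI[of _ k]) auto
  qed
  obtain j where j: "j < ?L" "j \<noteq> i" "even j \<longleftrightarrow> odd i" "vs ! Suc i = vs ! j" using next_ex by blast
  obtain l where l: "l < ?L" "l \<noteq> i" "even l \<longleftrightarrow> odd i" "vs ! Suc l = vs ! i" using prev_ex by blast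
  have ne: "es ! j \<noteq> e" "es ! l \<noteq> e" "es ! j \<in> set es" "es ! l \<in> set es"
    using d i j l by (auto simp: nth_eq_iff_index_eq)
  have "?f i \<and> ?b j \<and> ?b l \<or> ?b i \<and> ?f j \<and> ?f l"
    using par[OF i(1)] par[OF j(1)] par[OF l(1)] j(3) l(3) by (auto split: if_splits)
  then have "tail D (es ! l) = tail D e \<or> tail D (es ! j) = tail D e"
    and "head D (es ! l) = head D e \<or> head D (es ! j) = head D e"
    using i(2) j(4) l(4) unfolding forward_step_def backward_step_def by auto
  then show "\<exists>f\<in>set es. f \<noteq> e \<and> tail D f = tail D e"
    and "\<exists>f\<in>set es. f \<noteq> e \<and> head D f = head D e" using ne by blast+
qed

text \<open>The cases of the orientation are merged into one rule, with \<open>col\<close> true for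
  black: an arc leaves \<open>own e\<close> exactly if \<open>col (own e)\<close> agrees with
  \<open>e \<in> medges T\<close>. For an edge of T either end may serve as \<open>own e\<close>,
  since the rule directs it from black to white in both cases.\<close>

lemma owner_orientation_no_trail:
  assumes G: "finite_loopless G" and un: "edge_disjoint_union G T P"
    and T: "\<nexists>C. cycle_edges T C" and P: "\<And>C. cycle_edges P C \<Longrightarrow> odd (card C)"
    and inj: "inj_on own (medges P)"
    and col: "\<And>e. e \<in> medges T \<Longrightarrow> \<exists>x y. ends G e = {x, y} \<and> col x \<and> \<not> col y"
    and arcs: "arcs D = medges G"
    and or: "\<And>e. e \<in> medges G \<Longrightarrow> \<exists>w. ends G e = {own e, w} \<and>
      (if col (own e) \<longleftrightarrow> e \<in> medges T then tail D e = own e \<and> head D e = w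
       else tail D e = w \<and> head D e = own e)"
  shows "\<nexists>vs es. closed_antidirected_trail D vs es"
proof
  assume "\<exists>vs es. closed_antidirected_trail D vs es"
  then obtain vs es where tr: "closed_antidirected_trail D vs es" by blast
  have ht: "{tail D e, head D e} = ends G e" if "e \<in> medges G" for e
    using or[OF that] by (auto split: if_splits)
  have "card {tail D e, head D e} = 2" if "e \<in> arcs D" for e
    using ht that G arcs by (simp add: finite_loopless_def)
  then have loopless: "tail D e \<noteq> head D e" if "e \<in> arcs D" for e using that by fastforce
  define S where "S = set es"
  have SG: "S \<subseteq> medges G" and Sne: "S \<noteq> {}"
    using tr arcs unfolding S_def closed_antidirected_trail_def walk_def underlying_def by auto
  have ptail: "\<exists>f\<in>S. f \<noteq> e \<and> tail D f = tail D e"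
    and phead: "\<exists>f\<in>S. f \<noteq> e \<and> head D f = head D e" if "e \<in> S" for e
    using closed_antidirected_trail_partners[OF tr, of e] loopless that unfolding S_def by auto
  have TP: "medges G = medges T \<union> medges P" "medges T \<inter> medges P = {}"
    and endsT: "\<And>e. e \<in> medges T \<Longrightarrow> ends T e = ends G e"
    and endsP: "\<And>e. e \<in> medges P \<Longrightarrow> ends P e = ends G e"
    and flT: "finite_loopless T" and flP: "finite_loopless P"
    using un unfolding edge_disjoint_union_def submultigraph_def by auto
  show False
  proof (cases "S \<subseteq> medges T")
    case True
    let ?T = "T\<lparr>medges := S\<rparr>"
    have "finite_loopless ?T" "\<nexists>C. cycle_edges ?T C" "medges ?T \<noteq> {}"
      using finite_loopless_edges_update[OF flT True] acyclic_edges_update[OF T True] Sne by auto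
    then obtain a e where "edges_at (ends ?T) (medges ?T) a = {e}"
      using acyclic_two_leaves by metis
    then have ae: "edges_at (ends T) S a = {e}" by simp
    then have e: "e \<in> S" "a \<in> ends G e" using True endsT by (auto simp: edges_at_def)
    have "a = tail D e \<or> a = head D e" using e ht[of e] SG by blast
    moreover have "tail D f \<in> ends G f" "head D f \<in> ends G f" if "f \<in> S" for f
      using ht[of f] SG that by blast+
    ultimately have "\<exists>f\<in>S. f \<noteq> e \<and> a \<in> ends G f"
      using ptail[OF e(1)] phead[OF e(1)] by metis
    then obtain f where "f \<in> S" "f \<noteq> e" "a \<in> ends T f" using True endsT by auto
    with ae show False by (auto simp: edges_at_def)
  next
    case False
    define E where "E = S \<inter> medges P"
    have "E \<noteq> {}" using False SG TP by (auto simp: E_def)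
    \<comment> \<open>If \<open>own e\<close> is black, \<open>f\<close> is another trail arc
      entering it. Since \<open>f\<close> is in P and its owner is a different vertex,
      \<open>own e\<close> is the other end of \<open>f\<close>; so \<open>f\<close> leaves its own
      owner, which is therefore white. The white case is symmetric.\<close>
    have pred_ex: "\<exists>f\<in>E. ends G f = {own f, own e} \<and> col (own f) \<noteq> col (own e)" if e: "e \<in> E" for e
    proof -
      have eG: "e \<in> medges G" "e \<notin> medges T" "e \<in> S" using e SG TP by (auto simp: E_def)
      have own_side: "if col (own e) then head D e = own e else tail D e = own e"
        using or[OF eG(1)] eG(2) by (auto split: if_splits)
      obtain f where f: "f \<in> S" "f \<noteq> e"
        "if col (own e) then head D f = own e else tail D f = own e"
        using ptail[OF eG(3)] phead[OF eG(3)] own_side by (auto split: if_splits)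
      have fG: "f \<in> medges G" using f SG by auto
      obtain w where w: "ends G f = {own f, w}"
        "if col (own f) \<longleftrightarrow> f \<in> medges T then tail D f = own f \<and> head D f = w
         else tail D f = w \<and> head D f = own f" using or[OF fG] by blast
      have "f \<notin> medges T"
      proof
        assume fT: "f \<in> medges T"
        from col[OF fT] obtain x y where "ends G f = {x, y}" "col x" "\<not> col y" by blast
        with w fT f(3) show False by (auto simp: doubleton_eq_iff split: if_splits)
      qed
      then have fE: "f \<in> E" using f fG TP by (auto simp: E_def)
      then have "own f \<noteq> own e" using inj f(2) e unfolding inj_on_def E_def by blast
      with w f(3) \<open>f \<notin> medges T\<close> have "w = own e \<and> col (own f) \<noteq> col (own e)"
        by (auto split: if_splits)
      with w fE show ?thesis by blast
    qed
    define U where "U = own ` E"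
    define eo where "eo = inv_into E own"
    have injE: "inj_on own E" using inj by (rule inj_on_subset) (auto simp: E_def)
    have eo: "eo u \<in> E" "own (eo u) = u" if "u \<in> U" for u
      using that by (auto simp: eo_def U_def inv_into_into f_inv_into_f)
    have "\<forall>u\<in>U. \<exists>v\<in>U. ends G (eo v) = {v, u} \<and> col v \<noteq> col u"
    proof
      fix u assume "u \<in> U"
      then obtain e where e: "e \<in> E" "u = own e" by (auto simp: U_def)
      from pred_ex[OF e(1)] obtain f where f: "f \<in> E" "ends G f = {own f, own e}"
        "col (own f) \<noteq> col (own e)" by blast
      have "eo (own f) = f" using injE f(1) by (simp add: eo_def)
      with f e show "\<exists>v\<in>U. ends G (eo v) = {v, u} \<and> col v \<noteq> col u"
        by (intro bexI[of _ "own f"]) (auto simp: U_def)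
    qed
    then obtain h where h: "\<And>u. u \<in> U \<Longrightarrow> h u \<in> U"
      "\<And>u. u \<in> U \<Longrightarrow> ends G (eo (h u)) = {h u, u} \<and> col (h u) \<noteq> col u"
      by (metis (no_types, lifting))
    have "finite U" "U \<noteq> {}"
      using \<open>E \<noteq> {}\<close> flP by (auto simp: U_def E_def finite_loopless_def)
    then obtain x k where x: "x \<in> U" "k > 0" "(h ^^ k) x = x" "inj_on (\<lambda>i. (h ^^ i) x) {..<k}"
      and hU: "\<And>i. (h ^^ i) x \<in> U"
      using ex_minimal_period[of U h] h(1) by blast
    have parity: "col ((h ^^ i) x) \<longleftrightarrow> (col x \<longleftrightarrow> even i)" for i
      using h(2)[OF hU] by (induction i) auto
    from parity[of k] x(3) have "even k" by auto
    \<comment> \<open>The map \<open>h\<close> sends an owner to the owner of the edge found by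
      \<open>pred_ex\<close>. Thus \<open>eo ((h ^^ Suc i) x)\<close> joins vertices
      \<open>i\<close> and \<open>Suc i\<close> of the walk, which closes up after \<open>k\<close>
      steps.\<close>
    let ?vs = "map (\<lambda>i. (h ^^ i) x) [0..<Suc k]" and ?es = "map (\<lambda>i. eo ((h ^^ Suc i) x)) [0..<k]"
    have inj_Suc: "inj_on (\<lambda>i. (h ^^ Suc i) x) {..<k}"
    proof (rule inj_onI)
      fix i j assume ij: "i \<in> {..<k}" "j \<in> {..<k}" "(h ^^ Suc i) x = (h ^^ Suc j) x"
      \<comment> \<open>Going on for \<open>k - 1\<close> more steps completes a full period, so
        injectivity carries over from \<open>i\<close> to \<open>Suc i\<close>.\<close>
      have "(h ^^ (k - 1)) ((h ^^ Suc i) x) = (h ^^ i) x" for i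
      proof -
        have "(h ^^ (k - 1)) ((h ^^ Suc i) x) = (h ^^ (k - 1 + Suc i)) x"
          by (simp only: funpow_add comp_apply)
        also have "k - 1 + Suc i = i + k" using x(2) by simp
        also have "(h ^^ (i + k)) x = (h ^^ i) x" by (simp add: funpow_add x(3))
        finally show ?thesis .
      qed
      then have "(h ^^ i) x = (h ^^ j) x" using ij(3) by metis
      with x(4) ij show "i = j" by (auto dest: inj_onD)
    qed
    have eoP: "eo ((h ^^ i) x) \<in> medges P" for i using eo(1)[OF hU] by (auto simp: E_def)
    have "walk P ?vs ?es"
      unfolding walk_def
    proof (intro conjI allI impI)
      have "(h ^^ i) x \<in> mverts P" for i
      proof -
        have "eo ((h ^^ Suc i) x) \<in> medges P" by (rule eoP)
        moreover have "(h ^^ i) x \<in> ends G (eo ((h ^^ Suc i) x))" using h(2)[OF hU[of i]] by simp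
        ultimately show ?thesis using endsP flP unfolding finite_loopless_def by blast
      qed
      then show "set ?vs \<subseteq> mverts P" by auto
      show "set ?es \<subseteq> medges P" using eoP by (auto simp del: funpow.simps)
      fix i assume "i < length ?es"
      then show "ends P (?es ! i) = {?vs ! i, ?vs ! Suc i}"
        using endsP[OF eoP[of "Suc i"]] h(2)[OF hU[of i]]
        by (simp add: insert_commute del: upt_Suc)
    qed simp
    moreover have "length ?es \<ge> 2"
    proof -
      have "k \<noteq> 1" using \<open>even k\<close> by auto
      with x(2) show ?thesis by simp
    qed
    moreover have "hd ?vs = last ?vs" using x(3) by (simp add: hd_map last_map del: upt_Suc)
    moreover have "distinct (tl ?vs)"
    proof -
      have "[0..<Suc k] = 0 # map Suc [0..<k]"
        by (simp add: map_Suc_upt upt_conv_Cons del: upt_Suc)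
      then have "tl ?vs = map (\<lambda>i. (h ^^ Suc i) x) [0..<k]"
        by (simp add: comp_def del: upt_Suc)
      then show ?thesis using inj_Suc by (simp add: distinct_map atLeast0LessThan del: funpow.simps)
    qed
    moreover have des: "distinct ?es"
    proof -
      have "inj_on (\<lambda>i. eo ((h ^^ Suc i) x)) {..<k}"
      proof (rule inj_onI)
        fix i j assume ij: "i \<in> {..<k}" "j \<in> {..<k}" "eo ((h ^^ Suc i) x) = eo ((h ^^ Suc j) x)"
        then have "(h ^^ Suc i) x = (h ^^ Suc j) x" using eo(2)[OF hU] by metis
        with inj_Suc ij show "i = j" by (auto dest: inj_onD simp del: funpow.simps)
      qed
      then show ?thesis by (simp add: distinct_map atLeast0LessThan del: funpow.simps)
    qed
    ultimately have "cycle_edges P (set ?es)" unfolding cycle_edges_def by blast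
    then have "odd (card (set ?es))" by (rule P)
    with distinct_card[OF des] \<open>even k\<close> show False by simp
  qed
qed

section \<open>Timed execution of programs\<close>

text \<open>A total-correctness weakest precondition whose postcondition also sees the running time.
  The rules for instructions, \<open>Seq\<close> and \<open>Cond\<close> are equivalences, so
  straight-line code is executed by simplification.\<close>

definition runs :: "nat \<Rightarrow> prog \<Rightarrow> ram_state \<Rightarrow> (nat \<Rightarrow> ram_state \<Rightarrow> bool) \<Rightarrow> bool" where
  "runs W p s Q \<longleftrightarrow> (\<exists>t s'. exec W p s t s' \<and> Q t s')"

lemma runs_mono: "runs W p s Q \<Longrightarrow> (\<And>t s'. Q t s' \<Longrightarrow> Q' t s') \<Longrightarrow> runs W p s Q'"
  unfolding runs_def by blast

inductive_cases exec_DoE: "exec W (Do i) s t s'"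
inductive_cases exec_SeqE: "exec W (Seq p q) s t s'"
inductive_cases exec_CondE: "exec W (Cond b p q) s t s'"

lemma runs_Do: "runs W (Do i) s Q \<longleftrightarrow> (\<exists>s'. instr_step W i s = Some s' \<and> Q 1 s')"
  unfolding runs_def by (metis exec.Do exec_DoE)

lemma runs_instr [simp]:
  "runs W (Do (Const x k)) s Q \<longleftrightarrow> k \<le> W \<and> Q 1 (s\<lparr>reg := (reg s)(x := k)\<rparr>)"
  "runs W (Do (Move x y)) s Q \<longleftrightarrow> reg s y \<le> W \<and> Q 1 (s\<lparr>reg := (reg s)(x := reg s y)\<rparr>)"
  "runs W (Do (Plus x y z)) s Q \<longleftrightarrow>
     reg s y + reg s z \<le> W \<and> Q 1 (s\<lparr>reg := (reg s)(x := reg s y + reg s z)\<rparr>)"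
  "runs W (Do (Minus x y z)) s Q \<longleftrightarrow>
     reg s y - reg s z \<le> W \<and> Q 1 (s\<lparr>reg := (reg s)(x := reg s y - reg s z)\<rparr>)"
  "runs W (Do (Load x a y)) s Q \<longleftrightarrow>
     arr s a (reg s y) \<le> W \<and> Q 1 (s\<lparr>reg := (reg s)(x := arr s a (reg s y))\<rparr>)"
  "runs W (Do (Store a y x)) s Q \<longleftrightarrow>
     Q 1 (s\<lparr>arr := (arr s)(a := (arr s a)(reg s y := reg s x))\<rparr>)"
  by (simp_all add: runs_Do set_reg_def)

lemma runs_Seq [simp]:
  "runs W (Seq p q) s Q \<longleftrightarrow> runs W p s (\<lambda>t s'. runs W q s' (\<lambda>t' s''. Q (t + t') s''))"
  unfolding runs_def by (blast intro: exec.Seq elim!: exec_SeqE)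

lemma runs_Cond [simp]:
  "runs W (Cond b p q) s Q \<longleftrightarrow>
     (if test_holds b s then runs W p s (\<lambda>t. Q (Suc t)) else runs W q s (\<lambda>t. Q (Suc t)))"
  unfolding runs_def by (auto intro: exec.CondTrue exec.CondFalse elim!: exec_CondE)

text \<open>Here \<open>\<phi>\<close> is the time credit still available, which makes amortised bounds compositional.\<close>

lemma runs_Loop:
  assumes "I s"
    and step: "\<And>s. I s \<Longrightarrow> test_holds b s \<Longrightarrow> runs W p s (\<lambda>t s'. I s' \<and> t + 1 + \<phi> s' \<le> \<phi> s)"
    and post: "\<And>t s'. I s' \<Longrightarrow> \<not> test_holds b s' \<Longrightarrow> t + \<phi> s' \<le> \<phi> s + 1 \<Longrightarrow> Q t s'"
  shows "runs W (Loop b p) s Q"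
proof -
  have "\<exists>t s'. exec W (Loop b p) s t s' \<and> I s' \<and> \<not> test_holds b s' \<and> t + \<phi> s' \<le> \<phi> s + 1"
    using \<open>I s\<close>
  proof (induction "\<phi> s" arbitrary: s rule: less_induct)
    case less
    show ?case
    proof (cases "test_holds b s")
      case False
      then show ?thesis using exec.LoopFalse less.prems
        by (intro exI[of _ 1] exI[of _ s]) auto
    next
      case True
      from step[OF less.prems True] obtain t s' where s': "exec W p s t s'" "I s'"
        "t + 1 + \<phi> s' \<le> \<phi> s" unfolding runs_def by blast
      \<comment> \<open>Each round pays at least for its test, so the credit doubles as the
        termination measure. The \<open>+ 1\<close> in the final bound pays for the failing
        test.\<close>
      then have "\<phi> s' < \<phi> s" by simp
      from less.hyps[OF this s'(2)] obtain t' s'' where "exec W (Loop b p) s' t' s''" "I s''"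
        "\<not> test_holds b s''" "t' + \<phi> s'' \<le> \<phi> s' + 1" by blast
      with exec.LoopTrue[OF True s'(1)] s'(3) show ?thesis
        by (intro exI[of _ "Suc (t + t')"] exI[of _ s'']) auto
    qed
  qed
  with post show ?thesis unfolding runs_def by blast
qed

lemma runs_SeqI:
  assumes "runs W p s (\<lambda>t s'. t \<le> a \<and> P s')"
    and "\<And>s'. P s' \<Longrightarrow> runs W q s' (\<lambda>t s''. t \<le> b \<and> Q s'')"
  shows "runs W (Seq p q) s (\<lambda>t s''. t \<le> a + b \<and> Q s'')"
  unfolding runs_Seq
proof (rule runs_mono[OF assms(1)], elim conjE)
  fix t s' assume "t \<le> a" "P s'"
  then show "runs W q s' (\<lambda>t' s''. t + t' \<le> a + b \<and> Q s'')"
    by (intro runs_mono[OF assms(2)]) auto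
qed

text \<open>The empty block has to be an instruction. \<open>Move 0 0\<close> changes nothing, but
  it costs one step and requires register 0 to fit in a word.\<close>

fun block :: "prog list \<Rightarrow> prog" where
  "block [] = Do (Move 0 0)"
| "block [p] = p"
| "block (p # q # ps) = Seq p (block (q # ps))"

section \<open>The program\<close>

text \<open>
  Registers: 2 and 12 hold the constants 1 and 0, 3 the mark of the edges in question, 4 the loop
  counter, 5 the current vertex, 7 its last edge and 8 the other end of that edge, 10 the height
  of the stack; 6 and 9 are scratch, with the degree of the current vertex in 6 at the test of
  \<open>strip_chain\<close>. Arrays: 5 degrees, 6 sums of edge names, 7 owners (as vertex + 1, with 0 for an
  edge not yet removed), 8 the stack of stripped edges, 9 colours.
\<close>

definition attach :: "nat \<Rightarrow> nat \<Rightarrow> prog" where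
  "attach v e = block
    [Do (Load 6 5 v), Do (Plus 6 6 2), Do (Store 5 v 6),
     Do (Load 6 6 v), Do (Plus 6 6 e), Do (Store 6 v 6)]"

definition detach :: "nat \<Rightarrow> nat \<Rightarrow> prog" where
  "detach v e = block
    [Do (Load 6 5 v), Do (Minus 6 6 2), Do (Store 5 v 6),
     Do (Load 6 6 v), Do (Minus 6 6 e), Do (Store 6 v 6)]"

lemma runs_attach:
  assumes "v \<noteq> 6" "e \<noteq> 6" "reg s 2 = 1"
  shows "runs W (attach v e) s Q \<longleftrightarrow>
    arr s 5 (reg s v) + 1 \<le> W \<and> arr s 6 (reg s v) \<le> W \<and> arr s 6 (reg s v) + reg s e \<le> W \<and>
    Q 6 (s\<lparr>reg := (reg s)(6 := arr s 6 (reg s v) + reg s e),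
      arr := (arr s)(5 := (arr s 5)(reg s v := arr s 5 (reg s v) + 1),
        6 := (arr s 6)(reg s v := arr s 6 (reg s v) + reg s e))\<rparr>)"
  using assms by (auto simp: attach_def numeral_2_eq_2[symmetric])

lemma runs_detach:
  assumes "v \<noteq> 6" "e \<noteq> 6" "reg s 2 = 1"
  shows "runs W (detach v e) s Q \<longleftrightarrow>
    arr s 5 (reg s v) \<le> W \<and> arr s 6 (reg s v) \<le> W \<and>
    Q 6 (s\<lparr>reg := (reg s)(6 := arr s 6 (reg s v) - reg s e),
      arr := (arr s)(5 := (arr s 5)(reg s v := arr s 5 (reg s v) - 1),
        6 := (arr s 6)(reg s v := arr s 6 (reg s v) - reg s e))\<rparr>)"
  using assms by (auto simp: detach_def numeral_2_eq_2[symmetric])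

text \<open>Adds to arrays 5 and 6 without clearing them: they are 0 in the initial memory, and
  again 0 after every edge of T has been detached.\<close>

definition init_degrees :: prog where
  "init_degrees = block
    [Do (Const 4 0), Do (Const 10 0),
     Loop (Less 4 1) (block
      [Do (Load 9 2 4),
       Cond (Equal 9 3)
        (block [Do (Load 5 0 4), attach 5 4, Do (Load 5 1 4), attach 5 4])
        (block []),
       Do (Plus 4 4 2)])]"

text \<open>The other end of an edge is the sum of its two ends minus the known one. The last two
  instructions make it the current vertex and load its degree for the test of the chain.\<close>

definition strip_leaf :: prog where
  "strip_leaf = block
    [Do (Load 7 6 5), Do (Store 8 10 7), Do (Plus 10 10 2),
     Do (Load 8 0 7), Do (Load 9 1 7), Do (Plus 8 8 9), Do (Minus 8 8 5),
     Do (Plus 9 5 2), Do (Store 7 7 9),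
     detach 5 7, detach 8 7,
     Do (Move 5 8), Do (Load 6 5 5)]"

definition strip_chain :: prog where
  "strip_chain = Loop (Equal 6 2) strip_leaf"

definition strip_leaves :: prog where
  "strip_leaves = block
    [Do (Const 4 0),
     Loop (Less 4 0) (block [Do (Move 5 4), Do (Load 6 5 5), strip_chain, Do (Plus 4 4 2)])]"

text \<open>Edges are popped, and the owner of each gets 1 minus the colour of the other end.
  Vertices that own no edge of T keep the initial colour 0.\<close>

definition two_colour :: prog where
  "two_colour = Loop (Less 12 10) (block
    [Do (Minus 10 10 2), Do (Load 7 8 10), Do (Load 5 7 7), Do (Minus 5 5 2),
     Do (Load 8 0 7), Do (Load 9 1 7), Do (Plus 8 8 9), Do (Minus 8 8 5),
     Do (Load 9 9 8), Do (Minus 9 2 9), Do (Store 9 5 9)])"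

definition cut_edge :: prog where
  "cut_edge = block
    [Do (Load 5 0 4), Do (Plus 9 5 2), Do (Store 7 4 9), detach 5 4,
     Do (Load 5 1 4), detach 5 4, Do (Load 6 5 5)]"

text \<open>At the start all degrees are 0 or 2. Cutting an edge leaves both its ends with degree 1,
  and the chain started at the second end runs round the cycle to the first. The first end owns the
  cut edge, every other vertex the edge by which the chain leaves it.\<close>

definition break_cycles :: prog where
  "break_cycles = block
    [Do (Const 4 0),
     Loop (Less 4 1) (block
      [Do (Load 9 7 4),
       Cond (Equal 9 12)
        (block [cut_edge, strip_chain])
        (block []),
       Do (Plus 4 4 2)])]"

definition locate_owner :: prog where
  "locate_owner = block
    [Do (Load 5 7 4), Do (Minus 5 5 2),
     Do (Load 8 0 4), Do (Load 9 1 4), Do (Plus 8 8 9), Do (Minus 8 8 5),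
     Do (Load 6 9 5), Do (Load 9 2 4)]"

text \<open>Owner colour and edge mark are both 0 or 1, so a single comparison decides whether the
  arc leaves its owner.\<close>

definition write_arcs :: prog where
  "write_arcs = block
    [Do (Const 4 0),
     Loop (Less 4 1) (block
      [locate_owner,
       Cond (Equal 6 9)
        (block [Do (Store 3 4 5), Do (Store 4 4 8)])
        (block [Do (Store 3 4 8), Do (Store 4 4 5)]),
       Do (Plus 4 4 2)])]"

definition orient :: prog where
  "orient = block
    [Do (Const 2 1), Do (Const 3 1), init_degrees, strip_leaves, two_colour,
     Do (Const 3 0), init_degrees, strip_leaves, break_cycles, write_arcs]"

section \<open>Correctness of the program\<close>

text \<open>In the bound on \<open>W\<close>, \<open>2 * n\<close> allows for the sum of two ends,
  \<open>m * m\<close> for a sum of edge names and \<open>m + 1\<close> for names, degrees and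
  counters that are increased by one.\<close>

locale edge_arrays =
  fixes n m W :: nat and a0 a1 mk :: "nat \<Rightarrow> nat"
  assumes ends_less: "\<And>e. e < m \<Longrightarrow> a0 e < n" "\<And>e. e < m \<Longrightarrow> a1 e < n"
    and ends_neq: "\<And>e. e < m \<Longrightarrow> a0 e \<noteq> a1 e"
    and mk_le: "\<And>e. e < m \<Longrightarrow> mk e \<le> 1"
    and W: "2 * n + m * m + m + 1 \<le> W"
begin

abbreviation \<epsilon> :: "nat \<Rightarrow> nat set" where
  "\<epsilon> e \<equiv> {a0 e, a1 e}"

section \<open>Degrees and sums of edge names\<close>

definition deg :: "nat set \<Rightarrow> nat \<Rightarrow> nat" where
  "deg A v = card (edges_at \<epsilon> A v)"

definition idsum :: "nat set \<Rightarrow> nat \<Rightarrow> nat" where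
  "idsum A v = \<Sum>(edges_at \<epsilon> A v)"

lemma edges_at_insert: "edges_at \<epsilon> (insert e A) v =
    (if v \<in> \<epsilon> e then insert e (edges_at \<epsilon> A v) else edges_at \<epsilon> A v)"
  by (auto simp: edges_at_def)

lemma finite_edges_at: "finite A \<Longrightarrow> finite (edges_at \<epsilon> A v)"
  by (simp add: edges_at_def)

lemma count_insert:
  assumes "finite A" "e \<notin> A" "\<epsilon> e = {x, w}" "x \<noteq> w"
  shows "deg (insert e A) = (deg A)(x := deg A x + 1, w := deg A w + 1)"
    and "idsum (insert e A) = (idsum A)(x := idsum A x + e, w := idsum A w + e)"
proof -
  have "e \<notin> edges_at \<epsilon> A v" for v using assms(2) by (simp add: edges_at_def)
  then show "deg (insert e A) = (deg A)(x := deg A x + 1, w := deg A w + 1)"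
    and "idsum (insert e A) = (idsum A)(x := idsum A x + e, w := idsum A w + e)"
    using assms(1,3,4) unfolding deg_def idsum_def edges_at_insert
    by (auto simp: fun_eq_iff finite_edges_at)
qed

lemma count_remove:
  assumes "finite A" "e \<in> A" "\<epsilon> e = {x, w}" "x \<noteq> w"
  shows "deg (A - {e}) = (deg A)(x := deg A x - 1, w := deg A w - 1)"
    and "idsum (A - {e}) = (idsum A)(x := idsum A x - e, w := idsum A w - e)"
  using count_insert[of "A - {e}" e x w] assms by (auto simp: insert_absorb fun_eq_iff)

lemma deg_le: "A \<subseteq> {..<m} \<Longrightarrow> deg A v \<le> m"
  using card_mono[of "{..<m}" "edges_at \<epsilon> A v"] unfolding deg_def by (auto simp: edges_at_def)

lemma idsum_le:
  assumes "A \<subseteq> {..<m}"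
  shows "idsum A v \<le> m * m"
proof -
  have "idsum A v \<le> card (edges_at \<epsilon> A v) * m"
    unfolding idsum_def using assms sum_bounded_above[of "edges_at \<epsilon> A v" "\<lambda>e. e" m]
    by (simp add: edges_at_def subset_iff less_imp_le)
  also have "\<dots> \<le> m * m" using deg_le[OF assms] by (simp add: deg_def)
  finally show ?thesis .
qed

lemma count_empty [simp]: "deg {} = (\<lambda>_. 0)" "idsum {} = (\<lambda>_. 0)"
  by (simp_all add: fun_eq_iff deg_def idsum_def edges_at_def)

definition intact :: "ram_state \<Rightarrow> bool" where
  "intact s \<longleftrightarrow> reg s 0 = n \<and> reg s 1 = m \<and> reg s 2 = 1 \<and> reg s 12 = 0 \<and>
     arr s 0 = a0 \<and> arr s 1 = a1 \<and> arr s 2 = mk"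

definition counts :: "nat set \<Rightarrow> ram_state \<Rightarrow> bool" where
  "counts A s \<longleftrightarrow> arr s 5 = deg A \<and> arr s 6 = idsum A"

definition alive :: "nat set \<Rightarrow> ram_state \<Rightarrow> nat set" where
  "alive M s = {e \<in> M. arr s 7 e = 0}"

lemma intactD:
  assumes "intact s"
  shows "reg s 0 = n" "reg s 1 = m" "reg s (Suc 0) = m" "reg s 2 = 1" "reg s 12 = 0"
    "arr s 0 = a0" "arr s 1 = a1" "arr s (Suc 0) = a1" "arr s 2 = mk"
  using assms by (simp_all add: intact_def)

lemma init_degrees_runs:
  assumes s: "intact s" "arr s 5 = (\<lambda>_. 0)" "arr s 6 = (\<lambda>_. 0)" "reg s 3 = b"
  shows "runs W init_degrees s (\<lambda>t s'. t \<le> 20 * m + 3 \<and> intact s' \<and>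
    counts {e. e < m \<and> mk e = b} s' \<and> reg s' 10 = 0 \<and>
    (\<forall>a. a \<noteq> 5 \<longrightarrow> a \<noteq> 6 \<longrightarrow> arr s' a = arr s a))"
proof -
  define I where "I s' \<longleftrightarrow> intact s' \<and> reg s' 4 \<le> m \<and> counts {e. e < reg s' 4 \<and> mk e = b} s' \<and>
    reg s' 3 = b \<and> reg s' 10 = 0 \<and> (\<forall>a. a \<noteq> 5 \<longrightarrow> a \<noteq> 6 \<longrightarrow> arr s' a = arr s a)" for s'
  show ?thesis
    unfolding init_degrees_def
    apply simp
    \<comment> \<open>A round takes at most 17 steps and one test, within the credit of 20. The two
      constants and the last test make up the additive 3.\<close>
    apply (rule runs_Loop[where I = I and \<phi> = "\<lambda>s. 20 * (m - reg s 4)"])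
    subgoal
      using s by (auto simp: I_def intact_def counts_def)
    subgoal premises prems for s'
    proof -
      let ?e = "reg s' 4" and ?A = "{e. e < reg s' 4 \<and> mk e = b}"
      have sd: "intact s'" using prems by (simp add: I_def)
      have e: "?e < m" using prems intactD[OF sd] by simp
      have ins: "{e. e < Suc ?e \<and> mk e = b} = (if mk ?e = b then insert ?e ?A else ?A)"
        by (auto simp: less_Suc_eq)
      have sub: "insert ?e ?A \<subseteq> {..<m}" using e by auto
      note cnt = count_insert[of ?A ?e "a0 ?e" "a1 ?e"]
      have [simp]: "finite ?A" by auto
      have b1: "Suc (deg ?A (a0 ?e)) \<le> W" "Suc (deg ?A (a1 ?e)) \<le> W"
        "idsum ?A (a0 ?e) + ?e \<le> W" "idsum ?A (a1 ?e) + ?e \<le> W"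
        using deg_le[OF sub, of "a0 ?e"] deg_le[OF sub, of "a1 ?e"] W ends_neq[OF e]
          idsum_le[OF sub, of "a0 ?e"] idsum_le[OF sub, of "a1 ?e"]
        by (auto simp: cnt)
      have b2: "a0 ?e \<le> W" "a1 ?e \<le> W" "mk ?e \<le> W" "?e + 1 \<le> W"
        "n \<le> W" "20 * (m - ?e) = 20 + 20 * (m - Suc ?e)"
        using ends_less[OF e] mk_le[OF e] e W by auto
      have nq: "a0 ?e \<noteq> a1 ?e" "a1 ?e \<noteq> a0 ?e" using ends_neq[OF e] by auto
      have J: "counts ?A s'" "reg s' 3 = b" "reg s' 10 = 0"
        "\<forall>a. a \<noteq> 5 \<longrightarrow> a \<noteq> 6 \<longrightarrow> arr s' a = arr s a" using prems by (simp_all add: I_def)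
      show ?thesis
        using b1 b2 nq e J(2-)
        apply (simp add: runs_attach intactD[OF sd] J(1)[unfolded counts_def])
        apply (simp add: I_def intact_def counts_def intactD[OF sd] J(1)[unfolded counts_def] ins cnt)
        done
    qed
    subgoal premises prems for t s'
    proof -
      have sd: "intact s'" using prems by (simp add: I_def)
      then have "reg s' 4 = m" using prems intactD[OF sd] by (simp add: I_def)
      then show ?thesis using prems W intactD[OF s(1)] by (simp add: I_def)
    qed
    done
qed

section \<open>Stripping leaves\<close>

lemma alive_update:
  "e \<in> alive M s \<Longrightarrow> arr s' 7 = (arr s 7)(e := Suc x) \<Longrightarrow> alive M s' = alive M s - {e}"
  by (auto simp: alive_def)

text \<open>The time is exact: nine instructions up to the storing of the owner, twice 6 for
  \<open>detach\<close>, and two to move on. The hypothesis on register 10 keeps the new stack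
  height within a word.\<close>

lemma strip_leaf_runs:
  assumes s: "intact s" "M \<subseteq> {..<m}" "counts (alive M s) s"
    and leaf: "deg (alive M s) (reg s 5) = 1" and k: "reg s 10 < m"
  shows "runs W strip_leaf s (\<lambda>t s'. t = 23 \<and> intact s' \<and> (\<exists>e w.
    e \<in> alive M s \<and> \<epsilon> e = {reg s 5, w} \<and> w \<noteq> reg s 5 \<and> edges_at \<epsilon> (alive M s) (reg s 5) = {e} \<and>
    alive M s' = alive M s - {e} \<and> counts (alive M s') s' \<and>
    deg (alive M s') = (deg (alive M s))(reg s 5 := 0, w := deg (alive M s) w - 1) \<and>
    arr s' 7 = (arr s 7)(e := reg s 5 + 1) \<and> arr s' 8 = (arr s 8)(reg s 10 := e) \<and>
    arr s' 9 = arr s 9 \<and> reg s' 3 = reg s 3 \<and> reg s' 4 = reg s 4 \<and> reg s' 5 = w \<and>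
    reg s' 6 = deg (alive M s') w \<and> reg s' 10 = reg s 10 + 1))"
proof -
  let ?x = "reg s 5" and ?A = "alive M s"
  obtain e where e: "edges_at \<epsilon> ?A ?x = {e}" using leaf by (auto simp: deg_def card_1_singleton_iff)
  then have eA: "e \<in> ?A" "?x \<in> \<epsilon> e" unfolding edges_at_def by blast+
  have Am: "?A \<subseteq> {..<m}" using s(2) by (auto simp: alive_def)
  then have em: "e < m" and fin: "finite ?A" using eA finite_subset by auto
  define w where "w = a0 e + a1 e - ?x"
  have w: "\<epsilon> e = {?x, w}" "w \<noteq> ?x" using eA(2) ends_neq[OF em] by (auto simp: w_def)
  have sum: "idsum ?A ?x = e" by (simp add: idsum_def e)
  have xw: "?x < n" "w < n" using ends_less[OF em] w(1) by (auto simp: doubleton_eq_iff)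
  note rem = count_remove[OF fin eA(1) w(1) w(2)[symmetric]]
  have b: "a0 e \<le> W" "a1 e \<le> W" "a0 e + a1 e \<le> W" "e \<le> W" "?x + 1 \<le> W" "reg s 10 + 1 \<le> W" "w \<le> W"
    "deg ?A v \<le> W" "deg ?A v - Suc 0 \<le> W" "idsum ?A v \<le> W" for v
    using ends_less[OF em] W k em xw deg_le[OF Am, of v] idsum_le[OF Am, of v] by auto
  have dw: "w \<noteq> ?x" "?x \<noteq> w" using w(2) by auto
  have J: "arr s 5 = deg ?A" "arr s 6 = idsum ?A" using s(3) by (simp_all add: counts_def)
  have "alive M s' = ?A - {e}" if "arr s' 7 = (arr s 7)(e := Suc ?x)" for s'
    using that alive_update eA(1) by blast
  note al = this
  show ?thesis
    unfolding strip_leaf_def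
    using b dw leaf
    apply (simp add: runs_detach intactD[OF s(1)] J sum w_def[symmetric])
    apply (rule conjI)
     apply (simp add: intact_def intactD[OF s(1)])
    apply (rule exI[of _ e])
    apply (simp add: al eA w e counts_def rem J sum dw)
    done
qed

text \<open>The third clause is what reverse colouring needs: an owner lies on no edge stacked
  later. The fourth says the same of edges still to come; it preserves the third under a push, and
  at the end it gives the owners degree 0.\<close>

definition stack_ok :: "nat set \<Rightarrow> (nat \<Rightarrow> nat) \<Rightarrow> (nat \<Rightarrow> nat) \<Rightarrow> nat \<Rightarrow> bool" where
  "stack_ok M own S k \<longleftrightarrow>
     (\<forall>e\<in>M. own e \<noteq> 0 \<longrightarrow> (\<exists>i<k. S i = e)) \<and>
     (\<forall>i<k. S i \<in> M \<and> own (S i) \<noteq> 0 \<and> own (S i) - 1 \<in> \<epsilon> (S i)) \<and>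
     (\<forall>i<k. \<forall>j<i. own (S j) - 1 \<notin> \<epsilon> (S i)) \<and>
     (\<forall>j<k. \<forall>e\<in>M. own e = 0 \<longrightarrow> own (S j) - 1 \<notin> \<epsilon> e)"

lemma stack_ok_push:
  assumes S: "stack_ok M own S k" and e: "e \<in> M" "own e = 0" "x \<in> \<epsilon> e"
    and only: "\<And>f. f \<in> M \<Longrightarrow> own f = 0 \<Longrightarrow> x \<in> \<epsilon> f \<Longrightarrow> f = e"
  shows "stack_ok M (own(e := x + 1)) (S(k := e)) (k + 1)"
proof -
  have ne: "S i \<noteq> e" if "i < k" for i using S that e(2) by (auto simp: stack_ok_def)
  have 1: "\<exists>i<k + 1. (S(k := e)) i = f" if f: "f \<in> M" "(own(e := x + 1)) f \<noteq> 0" for f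
  proof (cases "f = e")
    case False
    then have "own f \<noteq> 0" using f(2) by simp
    then obtain i where "i < k" "S i = f" using S f(1) unfolding stack_ok_def by blast
    then show ?thesis by (intro exI[of _ i]) auto
  qed auto
  show ?thesis
    unfolding stack_ok_def
  proof (intro conjI allI ballI impI)
    fix i assume "i < k + 1"
    then show "(S(k := e)) i \<in> M" "(own(e := x + 1)) ((S(k := e)) i) \<noteq> 0"
      "(own(e := x + 1)) ((S(k := e)) i) - 1 \<in> \<epsilon> ((S(k := e)) i)"
      using S e ne by (auto simp: stack_ok_def less_Suc_eq)
    fix j assume "j < i"
    with \<open>i < k + 1\<close> show "(own(e := x + 1)) ((S(k := e)) j) - 1 \<notin> \<epsilon> ((S(k := e)) i)"
      using S e ne[of i] ne[of j] by (cases "i = k") (auto simp: stack_ok_def)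
  next
    fix j f assume "j < k + 1" "f \<in> M" "(own(e := x + 1)) f = 0"
    then show "(own(e := x + 1)) ((S(k := e)) j) - 1 \<notin> \<epsilon> f"
      using S only[of f] ne[of j] by (cases "j = k") (auto simp: stack_ok_def split: if_splits)
  qed (use 1 in blast)
qed

text \<open>A common owner of two stacked edges would lie on the later one, which the third clause
  of \<open>stack_ok\<close> excludes.\<close>

lemma stack_ok_inj:
  assumes "stack_ok M own S k"
  shows "inj_on own {e \<in> M. own e \<noteq> 0}"
proof -
  have "i = j" if "i < k" "j < k" "own (S i) = own (S j)" for i j
    using assms that unfolding stack_ok_def by (metis nat_neq_iff)
  with assms show ?thesis unfolding stack_ok_def inj_on_def by (metis (mono_tags, lifting) mem_Collect_eq)
qed

lemma strip_leaves_runs: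
  assumes s: "intact s" "M \<subseteq> {..<m}" "alive M s = M" "counts M s" "reg s 10 = 0"
  shows "runs W strip_leaves s (\<lambda>t s'. t \<le> 24 * card M + 5 * n + 2 \<and> intact s' \<and>
    counts (alive M s') s' \<and> stack_ok M (arr s' 7) (arr s' 8) (reg s' 10) \<and>
    reg s' 10 + card (alive M s') \<le> card M \<and> (\<forall>v. deg (alive M s') v \<noteq> 1) \<and>
    reg s' 3 = reg s 3 \<and> (\<forall>e. e \<notin> M \<longrightarrow> arr s' 7 e = arr s 7 e) \<and> arr s' 9 = arr s 9)"
proof -
  define I where "I s' \<longleftrightarrow> intact s' \<and> counts (alive M s') s' \<and>
    stack_ok M (arr s' 7) (arr s' 8) (reg s' 10) \<and> reg s' 10 + card (alive M s') \<le> card M \<and>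
    reg s' 3 = reg s 3 \<and> (\<forall>e. e \<notin> M \<longrightarrow> arr s' 7 e = arr s 7 e) \<and> arr s' 9 = arr s 9" for s'
  define I1 where "I1 s' \<longleftrightarrow> I s' \<and> reg s' 4 \<le> n \<and> (\<forall>v<reg s' 4. deg (alive M s') v \<noteq> 1)" for s'
  \<comment> \<open>The chain may walk back below the scan counter and turn a vertex there into a
    leaf, so the current vertex is exempt. The chain ends only when its degree is not 1, which
    restores \<open>I1\<close>.\<close>
  define I2 where "I2 s' \<longleftrightarrow> I s' \<and> reg s' 4 < n \<and> reg s' 6 = deg (alive M s') (reg s' 5) \<and>
    (\<forall>v\<le>reg s' 4. v \<noteq> reg s' 5 \<longrightarrow> deg (alive M s') v \<noteq> 1)" for s'
  have finM: "finite M" and cM: "card M \<le> m"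
    using s(2) finite_subset card_mono[of "{..<m}" M] by auto
  have finA: "finite (alive M s')" for s' using finM by (simp add: alive_def)
  have alm: "alive M s' \<subseteq> {..<m}" for s' using s(2) by (auto simp: alive_def)
  have chain: "runs W strip_chain s1 (\<lambda>t s'. I2 s' \<and> deg (alive M s') (reg s' 5) \<noteq> 1 \<and>
      t + 24 * card (alive M s') \<le> 24 * card (alive M s1) + 1 \<and> reg s' 4 = reg s1 4)"
    if "I2 s1" for s1
    unfolding strip_chain_def
  proof (rule runs_Loop[where I = "\<lambda>s'. I2 s' \<and> reg s' 4 = reg s1 4" and \<phi> = "\<lambda>s. 24 * card (alive M s)"])
    fix s2 assume I2: "I2 s2 \<and> reg s2 4 = reg s1 4" and te: "test_holds (Equal 6 2) s2"
    have st: "intact s2" and cn: "counts (alive M s2) s2" and d1: "deg (alive M s2) (reg s2 5) = 1"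
      using I2 te by (auto simp: I2_def I_def dest: intactD)
    have "alive M s2 \<noteq> {}" using d1 by auto
    then have c0: "card (alive M s2) > 0" using finA by (simp add: card_gt_0_iff)
    have k: "reg s2 10 < m" using I2 c0 cM by (auto simp: I2_def I_def)
    show "runs W strip_leaf s2 (\<lambda>t s'. (I2 s' \<and> reg s' 4 = reg s1 4) \<and>
      t + 1 + 24 * card (alive M s') \<le> 24 * card (alive M s2))"
    proof (rule runs_mono[OF strip_leaf_runs[OF st s(2) cn d1 k]], elim conjE exE)
      fix t :: nat and s' e w
      assume h: "t = 23" "intact s'" "e \<in> alive M s2" "\<epsilon> e = {reg s2 5, w}" "w \<noteq> reg s2 5"
        "edges_at \<epsilon> (alive M s2) (reg s2 5) = {e}" "alive M s' = alive M s2 - {e}"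
        "counts (alive M s') s'"
        "deg (alive M s') = (deg (alive M s2))(reg s2 5 := 0, w := deg (alive M s2) w - 1)"
        "arr s' 7 = (arr s2 7)(e := reg s2 5 + 1)" "arr s' 8 = (arr s2 8)(reg s2 10 := e)"
        "arr s' 9 = arr s2 9" "reg s' 3 = reg s2 3" "reg s' 4 = reg s2 4" "reg s' 5 = w"
        "reg s' 6 = deg (alive M s') w" "reg s' 10 = reg s2 10 + 1"
      have card: "card (alive M s2) = card (alive M s') + 1"
        using h(3,7) finA by (metis Suc_eq_plus1 card.remove)
      have "stack_ok M (arr s' 7) (arr s' 8) (reg s' 10)"
        unfolding h(10,11,17)
      proof (rule stack_ok_push)
        show "stack_ok M (arr s2 7) (arr s2 8) (reg s2 10)" using I2 by (simp add: I2_def I_def)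
        show "e \<in> M" "arr s2 7 e = 0" "reg s2 5 \<in> \<epsilon> e" using h(3,4) by (auto simp: alive_def)
        fix f assume "f \<in> M" "arr s2 7 f = 0" "reg s2 5 \<in> \<epsilon> f"
        then have "f \<in> edges_at \<epsilon> (alive M s2) (reg s2 5)" by (simp add: edges_at_def alive_def)
        then show "f = e" using h(6) by simp
      qed
      moreover have "e \<in> M" using h(3) by (simp add: alive_def)
      moreover have "deg (alive M s') v \<noteq> 1" if "v \<le> reg s' 4" "v \<noteq> w" for v
        using that I2 h(9,14) by (auto simp: I2_def)
      ultimately show "(I2 s' \<and> reg s' 4 = reg s1 4) \<and>
        t + 1 + 24 * card (alive M s') \<le> 24 * card (alive M s2)"
        using I2 h(1,2,8,12-) card unfolding h(10) I2_def I_def by auto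
    qed
  qed (use that in \<open>auto simp: I2_def I_def dest: intactD\<close>)
  show ?thesis
    unfolding strip_leaves_def
    apply simp
    \<comment> \<open>Each removed edge pays 23 steps and the test of the chain. Each scanned vertex
      pays three instructions, the failing test of the chain and the test of the scan.\<close>
    apply (rule runs_Loop[where I = I1 and \<phi> = "\<lambda>s. 24 * card (alive M s) + 5 * (n - reg s 4)"])
    subgoal
      using s by (auto simp: I1_def I_def intact_def counts_def alive_def stack_ok_def)
    subgoal premises prems for s1
    proof -
      have st: "intact s1" using prems by (simp add: I1_def I_def)
      have i: "reg s1 4 < n" using prems intactD[OF st] by simp
      let ?s = "s1\<lparr>reg := (reg s1)(5 := reg s1 4, 6 := arr s1 5 (reg s1 4))\<rparr>"
      have "I2 ?s" using prems i
        by (auto simp: I1_def I2_def I_def intact_def counts_def alive_def)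
      moreover have "alive M ?s = alive M s1" by (simp add: alive_def)
      moreover have "arr s1 5 (reg s1 4) \<le> W"
        using prems deg_le[OF alm, of s1 "reg s1 4"] W by (auto simp: I1_def I_def counts_def)
      ultimately show ?thesis
        using i W
        apply simp
        apply (rule runs_mono[OF chain])
         apply assumption
        apply (elim conjE)
        subgoal premises c for t s'
        proof -
          have st': "intact s'" using c by (simp add: I2_def I_def)
          have lt: "reg s' 4 < n" using c by (simp add: I2_def)
          have "deg (alive M s') v \<noteq> 1" if "v < Suc (reg s' 4)" for v
            using that c by (cases "v = reg s' 5") (auto simp: I2_def less_Suc_eq_le)
          moreover have "Suc (reg s' 4) \<le> W" using lt W by simp
          moreover have "5 * (n - reg s1 4) = 5 + 5 * (n - Suc (reg s1 4))" using i by simp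
          ultimately show ?thesis using c st' lt
            by (simp add: I1_def I2_def I_def intact_def counts_def alive_def)
        qed
        done
    qed
    subgoal premises prems for t s'
    proof -
      have st: "intact s'" using prems by (simp add: I1_def I_def)
      then have rn: "reg s' 4 = n" using prems intactD[OF st] by (simp add: I1_def)
      have "deg (alive M s') v \<noteq> 1" for v
      proof (cases "v < n")
        case True
        then show ?thesis using prems rn by (simp add: I1_def)
      next
        case False
        then have "edges_at \<epsilon> (alive M s') v = {}"
          using alm[of s'] ends_less unfolding edges_at_def by (fastforce simp: subset_iff)
        then show ?thesis by (simp add: deg_def)
      qed
      moreover have "alive M (s\<lparr>reg := (reg s)(4 := 0)\<rparr>) = M" using s(3) by (simp add: alive_def)
      ultimately show ?thesis using prems by (simp add: I1_def I_def)
    qed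
    done
qed

section \<open>Breaking the remaining cycles\<close>

lemma cut_edge_runs:
  assumes s: "intact s" "M \<subseteq> {..<m}" "counts (alive M s) s" and e: "reg s 4 \<in> alive M s"
  shows "runs W cut_edge s (\<lambda>t s'. t = 17 \<and> intact s' \<and>
    alive M s' = alive M s - {reg s 4} \<and> counts (alive M s') s' \<and>
    deg (alive M s') = (deg (alive M s))(a0 (reg s 4) := deg (alive M s) (a0 (reg s 4)) - 1,
      a1 (reg s 4) := deg (alive M s) (a1 (reg s 4)) - 1) \<and>
    arr s' 7 = (arr s 7)(reg s 4 := a0 (reg s 4) + 1) \<and> arr s' 9 = arr s 9 \<and>
    reg s' 4 = reg s 4 \<and> reg s' 5 = a1 (reg s 4) \<and>
    reg s' 6 = deg (alive M s') (a1 (reg s 4)) \<and> reg s' 10 = reg s 10)"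
proof -
  let ?e = "reg s 4" and ?A = "alive M s"
  have Am: "?A \<subseteq> {..<m}" using s(2) by (auto simp: alive_def)
  then have em: "?e < m" and fin: "finite ?A" using e finite_subset by auto
  have nq: "a0 ?e \<noteq> a1 ?e" "a1 ?e \<noteq> a0 ?e" using ends_neq[OF em] by auto
  note rem = count_remove[OF fin e refl nq(1)]
  have b: "a0 ?e + 1 \<le> W" "a1 ?e \<le> W" "?e \<le> W"
    "deg ?A v \<le> W" "deg ?A v - Suc 0 \<le> W" "idsum ?A v \<le> W" for v
    using ends_less[OF em] W em deg_le[OF Am, of v] idsum_le[OF Am, of v] by auto
  have J: "arr s 5 = deg ?A" "arr s 6 = idsum ?A" using s(3) by (simp_all add: counts_def)
  have al: "alive M s' = ?A - {?e}" if "arr s' 7 = (arr s 7)(?e := Suc (a0 ?e))" for s'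
    using that alive_update e by blast
  show ?thesis
    unfolding cut_edge_def
    using b nq
    apply (simp add: runs_detach intactD[OF s(1)] J)
    apply (rule conjI)
     apply (simp add: intact_def intactD[OF s(1)])
    apply (simp add: al counts_def rem J)
    done
qed

lemma owner_push:
  assumes "inj_on own {e \<in> M. own e \<noteq> 0}"
    and "\<And>f. f \<in> M \<Longrightarrow> own f \<noteq> 0 \<Longrightarrow> own f \<noteq> x + (1 :: nat)"
  shows "inj_on (own(e := x + 1)) {f \<in> M. (own(e := x + 1)) f \<noteq> 0}"
proof (rule inj_onI)
  fix f g
  assume f: "f \<in> {f \<in> M. (own(e := x + 1)) f \<noteq> 0}" and g: "g \<in> {f \<in> M. (own(e := x + 1)) f \<noteq> 0}"
    and eq: "(own(e := x + 1)) f = (own(e := x + 1)) g"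
  consider "f = e" "g = e" | "f = e" "g \<noteq> e" | "f \<noteq> e" "g = e" | "f \<noteq> e" "g \<noteq> e" by blast
  then show "f = g"
  proof cases
    case 2
    then have "own g = x + 1" "g \<in> M" using g eq by simp_all
    with assms(2)[of g] show ?thesis by simp
  next
    case 3
    then have "own f = x + 1" "f \<in> M" using f eq by simp_all
    with assms(2)[of f] show ?thesis by simp
  next
    case 4
    then have "own f = own g" "f \<in> {e \<in> M. own e \<noteq> 0}" "g \<in> {e \<in> M. own e \<noteq> 0}"
      using f g eq by simp_all
    then show ?thesis by (rule inj_onD[OF assms(1)])
  qed simp
qed

text \<open>\<open>Z\<close> holds owners that may still have edges; in use it is empty or just the
  first end of the cut edge. All other owners have degree 0, so a vertex outside \<open>Z\<close>
  that still has an edge is not yet an owner and can become one without spoiling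
  injectivity.\<close>

definition owned :: "nat set \<Rightarrow> ram_state \<Rightarrow> nat set \<Rightarrow> ram_state \<Rightarrow> bool" where
  "owned M s\<^sub>0 Z s \<longleftrightarrow> intact s \<and> counts (alive M s) s \<and> reg s 10 + card (alive M s) \<le> m \<and>
     inj_on (arr s 7) {e \<in> M. arr s 7 e \<noteq> 0} \<and>
     (\<forall>e\<in>M. arr s 7 e \<noteq> 0 \<longrightarrow> arr s 7 e - 1 \<in> \<epsilon> e \<and>
       (arr s 7 e - 1 \<in> Z \<or> deg (alive M s) (arr s 7 e - 1) = 0)) \<and>
     (\<forall>e. e \<notin> M \<longrightarrow> arr s 7 e = arr s\<^sub>0 7 e) \<and> arr s 9 = arr s\<^sub>0 9"

lemma deg_alive_pos:
  assumes "M \<subseteq> {..<m}" "e \<in> alive M s" "v \<in> \<epsilon> e"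
  shows "deg (alive M s) v \<noteq> 0"
proof -
  have "finite (alive M s)" by (rule finite_subset[of _ "{..<m}"]) (use assms(1) in \<open>auto simp: alive_def\<close>)
  then have "finite (edges_at \<epsilon> (alive M s) v)" by (rule finite_edges_at)
  moreover have "e \<in> edges_at \<epsilon> (alive M s) v" using assms by (simp add: edges_at_def)
  ultimately show ?thesis unfolding deg_def by auto
qed

lemma break_cycles_runs:
  assumes s: "intact s" "M \<subseteq> {..<m}" "owned M s {} s"
    and M: "\<And>e. e < m \<Longrightarrow> e \<notin> M \<Longrightarrow> arr s 7 e \<noteq> 0 \<and> arr s 7 e \<le> n"
    and d02: "\<And>v. deg (alive M s) v \<in> {0, 2}"
  shows "runs W break_cycles s (\<lambda>t s'. t \<le> 24 * card M + 22 * m + 2 \<and> owned M s {} s' \<and>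
    (\<forall>e<m. arr s' 7 e \<noteq> 0))"
proof -
  define I1 where "I1 s' \<longleftrightarrow> owned M s {} s' \<and> (\<forall>v. deg (alive M s') v \<in> {0, 2}) \<and> reg s' 4 \<le> m \<and>
    (\<forall>e<reg s' 4. arr s' 7 e \<noteq> 0)" for s'
  \<comment> \<open>What is left of the cut cycle is a path from \<open>u\<close> to the current
    vertex, so these two have degree 1. They coincide exactly when the path is used up.\<close>
  define I2 where "I2 u s' \<longleftrightarrow> owned M s {u} s' \<and> reg s' 4 < m \<and>
    reg s' 6 = deg (alive M s') (reg s' 5) \<and>
    (\<forall>v. v \<noteq> u \<longrightarrow> v \<noteq> reg s' 5 \<longrightarrow> deg (alive M s') v \<in> {0, 2}) \<and>
    (if reg s' 5 = u then deg (alive M s') u = 0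
     else deg (alive M s') u = 1 \<and> deg (alive M s') (reg s' 5) = 1) \<and>
    (\<forall>e\<le>reg s' 4. arr s' 7 e \<noteq> 0)" for u s'
  have finM: "finite M" and cM: "card M \<le> m"
    using s(2) finite_subset card_mono[of "{..<m}" M] by auto
  have finA: "finite (alive M s')" for s' using finM by (simp add: alive_def)
  have chain: "runs W strip_chain s1 (\<lambda>t s'. owned M s {} s' \<and> (\<forall>v. deg (alive M s') v \<in> {0, 2}) \<and>
      t + 24 * card (alive M s') \<le> 24 * card (alive M s1) + 1 \<and> reg s' 4 = reg s1 4 \<and>
      (\<forall>e\<le>reg s' 4. arr s' 7 e \<noteq> 0))"
    if "I2 u s1" for u s1
    unfolding strip_chain_def
  proof (rule runs_Loop[where I = "\<lambda>s'. I2 u s' \<and> reg s' 4 = reg s1 4" and \<phi> = "\<lambda>s. 24 * card (alive M s)"])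
    fix s2 assume I2: "I2 u s2 \<and> reg s2 4 = reg s1 4" and te: "test_holds (Equal 6 2) s2"
    have ow: "owned M s {u} s2" using I2 by (simp add: I2_def)
    have st: "intact s2" and cn: "counts (alive M s2) s2" and d1: "deg (alive M s2) (reg s2 5) = 1"
      using I2 te by (auto simp: I2_def owned_def dest: intactD)
    have xu: "reg s2 5 \<noteq> u" "deg (alive M s2) u = 1"
      using I2 d1 by (auto simp: I2_def split: if_splits)
    have "alive M s2 \<noteq> {}" using d1 by auto
    then have c0: "card (alive M s2) > 0" using finA by (simp add: card_gt_0_iff)
    have k: "reg s2 10 < m" using I2 c0 cM by (auto simp: I2_def owned_def)
    show "runs W strip_leaf s2 (\<lambda>t s'. (I2 u s' \<and> reg s' 4 = reg s1 4) \<and>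
      t + 1 + 24 * card (alive M s') \<le> 24 * card (alive M s2))"
    proof (rule runs_mono[OF strip_leaf_runs[OF st s(2) cn d1 k]], elim conjE exE)
      fix t :: nat and s' e w
      assume h: "t = 23" "intact s'" "e \<in> alive M s2" "\<epsilon> e = {reg s2 5, w}" "w \<noteq> reg s2 5"
        "edges_at \<epsilon> (alive M s2) (reg s2 5) = {e}" "alive M s' = alive M s2 - {e}"
        "counts (alive M s') s'"
        "deg (alive M s') = (deg (alive M s2))(reg s2 5 := 0, w := deg (alive M s2) w - 1)"
        "arr s' 7 = (arr s2 7)(e := reg s2 5 + 1)" "arr s' 8 = (arr s2 8)(reg s2 10 := e)"
        "arr s' 9 = arr s2 9" "reg s' 3 = reg s2 3" "reg s' 4 = reg s2 4" "reg s' 5 = w"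
        "reg s' 6 = deg (alive M s') w" "reg s' 10 = reg s2 10 + 1"
      have card: "card (alive M s2) = card (alive M s') + 1"
        using h(3,7) finA by (metis Suc_eq_plus1 card.remove)
      have eM: "e \<in> M" using h(3) by (simp add: alive_def)
      have dw: "deg (alive M s2) w \<noteq> 0"
        using deg_alive_pos[OF s(2) h(3), of w] h(4) by simp
      have "inj_on (arr s' 7) {f \<in> M. arr s' 7 f \<noteq> 0}"
        unfolding h(10)
      proof (rule owner_push)
        show "inj_on (arr s2 7) {f \<in> M. arr s2 7 f \<noteq> 0}" using ow by (simp add: owned_def)
        fix f assume "f \<in> M" "arr s2 7 f \<noteq> 0"
        with ow have "arr s2 7 f - 1 = u \<or> deg (alive M s2) (arr s2 7 f - 1) = 0"
          by (simp add: owned_def)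
        then show "arr s2 7 f \<noteq> reg s2 5 + 1" using xu d1 by auto
      qed
      moreover have "arr s' 7 f - 1 \<in> \<epsilon> f \<and> (arr s' 7 f - 1 \<in> {u} \<or> deg (alive M s') (arr s' 7 f - 1) = 0)"
        if "f \<in> M" "arr s' 7 f \<noteq> 0" for f
      proof (cases "f = e")
        case True
        then show ?thesis using h(4,5) unfolding h(9,10) by simp
      next
        case False
        with that h(10) have f: "arr s' 7 f = arr s2 7 f" "arr s2 7 f \<noteq> 0" by simp_all
        have "arr s2 7 f - 1 \<in> \<epsilon> f \<and> (arr s2 7 f - 1 \<in> {u} \<or> deg (alive M s2) (arr s2 7 f - 1) = 0)"
          using ow f(2) that(1) by (simp add: owned_def)
        then show ?thesis unfolding f(1) h(9) by auto
      qed
      moreover have "\<forall>f. f \<notin> M \<longrightarrow> arr s' 7 f = arr s 7 f"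
        using ow eM by (auto simp: owned_def h(10))
      ultimately have "owned M s {u} s'"
        using ow h(2,8,12,17) card unfolding owned_def by simp
      moreover have "deg (alive M s') v \<in> {0, 2}" if "v \<noteq> u" "v \<noteq> w" for v
        using that I2 by (auto simp: h(9) I2_def)
      moreover have "if w = u then deg (alive M s') u = 0
          else deg (alive M s') u = 1 \<and> deg (alive M s') w = 1"
      proof (cases "w = u")
        case False
        then have "deg (alive M s2) w \<in> {0, 2}" using I2 h(5) by (simp add: I2_def)
        with dw False xu show ?thesis by (simp add: h(9))
      qed (use xu in \<open>simp add: h(9)\<close>)
      ultimately show "(I2 u s' \<and> reg s' 4 = reg s1 4) \<and>
        t + 1 + 24 * card (alive M s') \<le> 24 * card (alive M s2)"
        using I2 h(1) card by (auto simp: I2_def h(10,14-16))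
    qed
  next
    fix t s'
    assume h: "I2 u s' \<and> reg s' 4 = reg s1 4" "\<not> test_holds (Equal 6 2) s'"
      "t + 24 * card (alive M s') \<le> 24 * card (alive M s1) + 1"
    have "intact s'" using h(1) by (simp add: I2_def owned_def)
    \<comment> \<open>As long as the current vertex differs from \<open>u\<close> its degree is 1,
      so the chain can only stop at \<open>u\<close>.\<close>
    then have "deg (alive M s') (reg s' 5) \<noteq> 1" using h by (auto simp: I2_def dest: intactD)
    then have x: "reg s' 5 = u" "deg (alive M s') u = 0"
      using h(1) by (auto simp: I2_def split: if_splits)
    \<comment> \<open>\<open>u\<close> has lost its last edge and needs no exemption any
      more.\<close>
    have "owned M s {} s'" using h(1) x(2) unfolding I2_def owned_def by fastforce
    moreover have "deg (alive M s') v \<in> {0, 2}" for v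
      using h(1) x by (cases "v = u") (auto simp: I2_def)
    ultimately show "owned M s {} s' \<and> (\<forall>v. deg (alive M s') v \<in> {0, 2}) \<and>
      t + 24 * card (alive M s') \<le> 24 * card (alive M s1) + 1 \<and> reg s' 4 = reg s1 4 \<and>
      (\<forall>e\<le>reg s' 4. arr s' 7 e \<noteq> 0)" using h by (auto simp: I2_def)
  qed (use that in simp)
  have cut: "runs W cut_edge s1 (\<lambda>t s'. t = 17 \<and> I2 (a0 (reg s1 4)) s' \<and> reg s' 4 = reg s1 4 \<and>
      card (alive M s') \<le> card (alive M s1))"
    if I1: "I1 s1" and e: "reg s1 4 \<in> alive M s1" for s1
  proof -
    let ?e = "reg s1 4"
    have ow: "owned M s {} s1" and deg02: "\<And>v. deg (alive M s1) v \<in> {0, 2}"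
      using I1 by (auto simp: I1_def)
    have st: "intact s1" "counts (alive M s1) s1" using ow by (auto simp: owned_def)
    have eM: "?e \<in> M" and em: "?e < m" using e s(2) by (auto simp: alive_def)
    note nq = ends_neq[OF em]
    have d2: "deg (alive M s1) (a0 ?e) = 2" "deg (alive M s1) (a1 ?e) = 2"
      using deg02[of "a0 ?e"] deg02[of "a1 ?e"] deg_alive_pos[OF s(2) e] by auto
    show ?thesis
    proof (rule runs_mono[OF cut_edge_runs[OF st(1) s(2) st(2) e]], elim conjE)
      fix t :: nat and s'
      assume h: "t = 17" "intact s'" "alive M s' = alive M s1 - {?e}" "counts (alive M s') s'"
        "deg (alive M s') = (deg (alive M s1))(a0 ?e := deg (alive M s1) (a0 ?e) - 1,
          a1 ?e := deg (alive M s1) (a1 ?e) - 1)"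
        "arr s' 7 = (arr s1 7)(?e := a0 ?e + 1)" "arr s' 9 = arr s1 9" "reg s' 4 = ?e"
        "reg s' 5 = a1 ?e" "reg s' 6 = deg (alive M s') (a1 ?e)" "reg s' 10 = reg s1 10"
      have card: "card (alive M s') \<le> card (alive M s1)"
        unfolding h(3) using finA by (intro card_mono) auto
      have "inj_on (arr s' 7) {f \<in> M. arr s' 7 f \<noteq> 0}"
        unfolding h(6)
      proof (rule owner_push)
        show "inj_on (arr s1 7) {f \<in> M. arr s1 7 f \<noteq> 0}" using ow by (simp add: owned_def)
        fix f assume "f \<in> M" "arr s1 7 f \<noteq> 0"
        with ow have "deg (alive M s1) (arr s1 7 f - 1) = 0" by (simp add: owned_def)
        then show "arr s1 7 f \<noteq> a0 ?e + 1" using d2 by auto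
      qed
      moreover have "arr s' 7 f - 1 \<in> \<epsilon> f \<and>
          (arr s' 7 f - 1 \<in> {a0 ?e} \<or> deg (alive M s') (arr s' 7 f - 1) = 0)"
        if "f \<in> M" "arr s' 7 f \<noteq> 0" for f
      proof (cases "f = ?e")
        case True
        then show ?thesis unfolding h(6) by simp
      next
        case False
        with that h(6) have f: "arr s' 7 f = arr s1 7 f" "arr s1 7 f \<noteq> 0" by simp_all
        have "arr s1 7 f - 1 \<in> \<epsilon> f \<and> deg (alive M s1) (arr s1 7 f - 1) = 0"
          using ow f(2) that(1) by (simp add: owned_def)
        then show ?thesis unfolding f(1) h(5) by auto
      qed
      moreover have "\<forall>f. f \<notin> M \<longrightarrow> arr s' 7 f = arr s 7 f"
        using ow eM by (auto simp: owned_def h(6))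
      ultimately have "owned M s {a0 ?e} s'"
        using ow h(2,4,7,11) card unfolding owned_def by simp
      moreover have "deg (alive M s') v \<in> {0, 2}" if "v \<noteq> a0 ?e" "v \<noteq> a1 ?e" for v
        using that deg02[of v] by (simp add: h(5))
      moreover have "arr s' 7 f \<noteq> 0" if "f \<le> ?e" for f
        using that I1 by (cases "f = ?e") (auto simp: h(6) I1_def)
      ultimately show "t = 17 \<and> I2 (a0 ?e) s' \<and> reg s' 4 = ?e \<and> card (alive M s') \<le> card (alive M s1)"
        using em nq d2 h(1,5) card unfolding I2_def h(8-10) by simp
    qed
  qed
  show ?thesis
    unfolding break_cycles_def
    apply simp
    \<comment> \<open>The 22 consists of 17 for the cut, the failing test of the chain, the load,
      the conditional, the increment and the loop test.\<close>
    apply (rule runs_Loop[where I = I1 and \<phi> = "\<lambda>s. 24 * card (alive M s) + 22 * (m - reg s 4)"])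
    subgoal
      using s d02 by (auto simp: I1_def owned_def intact_def counts_def alive_def)
    subgoal premises prems for s1
    proof -
      have ow: "owned M s {} s1" using prems by (simp add: I1_def)
      then have st: "intact s1" by (simp add: owned_def)
      have i: "reg s1 4 < m" using prems intactD[OF st] by simp
      let ?e = "reg s1 4"
      let ?s = "s1\<lparr>reg := (reg s1)(9 := arr s1 7 ?e)\<rparr>"
      have al: "alive M ?s = alive M s1" by (simp add: alive_def)
      have I1: "I1 ?s" using prems by (simp add: I1_def owned_def al intact_def counts_def)
      have step: "22 * (m - ?e) = 22 + 22 * (m - Suc ?e)" using i by simp
      have own_le: "arr s1 7 ?e \<le> n"
      proof (cases "?e \<in> M")
        case True
        then have "arr s1 7 ?e = 0 \<or> arr s1 7 ?e - 1 \<in> \<epsilon> ?e" using ow by (auto simp: owned_def)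
        then show ?thesis using ends_less[OF i] by auto
      next
        case False
        then show ?thesis using M[OF i] ow by (simp add: owned_def)
      qed
      show ?thesis
      proof (cases "arr s1 7 ?e = 0")
        case True
        then have "?e \<in> M" using M[OF i] ow by (force simp: owned_def)
        with True have eA: "reg ?s 4 \<in> alive M ?s" by (simp add: alive_def)
        show ?thesis
          using True intactD[OF st]
          apply simp
          apply (rule runs_mono[OF cut[OF I1 eA, unfolded True, simplified]])
          apply (elim conjE)
          apply (rule runs_mono[OF chain])
           apply assumption
          apply (elim conjE)
          subgoal premises c for t s2 t' s3
          proof -
            have ow3: "owned M s {} s3" and d3: "\<forall>v. deg (alive M s3) v \<in> {0, 2}"
              and r4: "reg s3 4 = ?e" and own3: "\<forall>f\<le>?e. arr s3 7 f \<noteq> 0"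
              and time: "t = 17" "t' + 24 * card (alive M s3) \<le> 24 * card (alive M s1) + 1"
              using c al True by simp_all
            have st3: "intact s3" using ow3 by (simp add: owned_def)
            let ?s3 = "s3\<lparr>reg := (reg s3)(4 := Suc ?e)\<rparr>"
            have al3: "alive M ?s3 = alive M s3" by (simp add: alive_def)
            have "owned M s {} ?s3" using ow3 unfolding owned_def al3 by (simp add: intact_def counts_def)
            then have "I1 ?s3" using d3 own3 i unfolding I1_def al3 by (simp add: less_Suc_eq_le)
            moreover have "Suc ?e \<le> W" using i W by simp
            ultimately show ?thesis
              using time step by (simp add: r4 intactD[OF st3] al3)
          qed
          done
      next
        case False
        \<comment> \<open>The update \<open>0 := n\<close> is the trace of the empty block, which
          moves register 0 to itself.\<close>
        let ?s1 = "s1\<lparr>reg := (reg s1)(9 := arr s1 7 ?e, 0 := n, 4 := Suc ?e)\<rparr>"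
        have al1: "alive M ?s1 = alive M s1" by (simp add: alive_def)
        have "owned M s {} ?s1" using ow unfolding owned_def al1 by (simp add: intact_def counts_def)
        moreover have "\<forall>v. deg (alive M s1) v \<in> {0, 2}" "\<forall>f<?e. arr s1 7 f \<noteq> 0"
          using prems(1) by (simp_all add: I1_def)
        ultimately have "I1 ?s1" using False i unfolding I1_def al1 by (simp add: less_Suc_eq)
        moreover have "Suc ?e \<le> W" "arr s1 7 ?e \<le> W" "n \<le> W" using i W own_le by simp_all
        ultimately show ?thesis using False step by (simp add: intactD[OF st] al1)
      qed
    qed
    subgoal premises prems for t s'
    proof -
      have st: "intact s'" using prems by (simp add: I1_def owned_def)
      then have "reg s' 4 = m" using prems intactD[OF st] by (simp add: I1_def)
      moreover have "card (alive M (s\<lparr>reg := (reg s)(4 := 0)\<rparr>)) \<le> card M"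
        using finM by (intro card_mono) (auto simp: alive_def)
      ultimately show ?thesis using prems by (simp add: I1_def)
    qed
    done
qed

section \<open>Colouring the tree and writing the arcs\<close>

lemma two_colour_runs:
  assumes s: "intact s" "M \<subseteq> {..<m}" "reg s 10 \<le> m" "arr s 9 = (\<lambda>_. 0)"
    and S: "stack_ok M (arr s 7) (arr s 8) (reg s 10)"
    and M: "\<And>e. e \<in> M \<Longrightarrow> arr s 7 e \<noteq> 0"
  shows "runs W two_colour s (\<lambda>t s'. t \<le> 12 * m + 1 \<and> intact s' \<and> (\<forall>v. arr s' 9 v \<le> 1) \<and>
    (\<forall>e\<in>M. arr s' 9 (a0 e) \<noteq> arr s' 9 (a1 e)) \<and> (\<forall>a. a \<noteq> 9 \<longrightarrow> arr s' a = arr s a))"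
proof -
  define I where "I s' \<longleftrightarrow> intact s' \<and> reg s' 10 \<le> reg s 10 \<and> (\<forall>v. arr s' 9 v \<le> 1) \<and>
    (\<forall>i<reg s 10. reg s' 10 \<le> i \<longrightarrow> arr s' 9 (a0 (arr s 8 i)) \<noteq> arr s' 9 (a1 (arr s 8 i))) \<and>
    (\<forall>a. a \<noteq> 9 \<longrightarrow> arr s' a = arr s a)" for s'
  show ?thesis
    unfolding two_colour_def
  proof (rule runs_Loop[where I = I and \<phi> = "\<lambda>s. 12 * reg s 10"], goal_cases)
    case 1
    then show ?case using s by (simp add: I_def)
  next
    case (2 s1)
    note I1 = 2(1)[unfolded I_def]
    then have st: "intact s1" by simp
    define i where "i = reg s1 10 - 1"
    have i: "reg s1 10 = Suc i" "i < reg s 10" using 2(2) I1 intactD[OF st] by (auto simp: i_def)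
    define e where "e = arr s 8 i"
    define x where "x = arr s 7 e - Suc 0"
    define w where "w = a0 e + a1 e - x"
    have e: "e \<in> M" "arr s 7 e \<noteq> 0" "x \<in> \<epsilon> e" using S i(2) by (auto simp: stack_ok_def e_def x_def)
    have em: "e < m" using e s(2) by auto
    have xw: "\<epsilon> e = {x, w}" "x \<noteq> w" using e(3) ends_neq[OF em] by (auto simp: w_def)
    \<comment> \<open>The edges already popped avoid \<open>x\<close>, so colouring \<open>x\<close>
      now leaves them properly coloured.\<close>
    have later: "x \<notin> \<epsilon> (arr s 8 j)" if "i < j" "j < reg s 10" for j
      using S that by (auto simp: stack_ok_def e_def x_def)
    have col: "arr s1 9 v \<le> 1" for v using I1 by blast
    have same: "arr s1 8 = arr s 8" "arr s1 7 = arr s 7" using I1 by auto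
    have "x < n" using xw(1) ends_less[OF em] by (auto simp: doubleton_eq_iff)
    then have own_le: "arr s 7 e \<le> W" "x \<le> W" using W by (auto simp: x_def)
    have b: "i \<le> W" "e \<le> W" "a0 e \<le> W" "a1 e \<le> W" "a0 e + a1 e \<le> W" "w \<le> W"
      using ends_less[OF em] em W i s(3) by (auto simp: w_def)
    have b': "arr s1 9 w \<le> W" "Suc 0 - arr s1 9 w \<le> W" using col[of w] W by auto
    let ?c = "(arr s1 9)(x := 1 - arr s1 9 w)"
    have proper: "?c (a0 (arr s 8 j)) \<noteq> ?c (a1 (arr s 8 j))" if "j < reg s 10" "i \<le> j" for j
    proof (cases "j = i")
      case True
      have "1 - arr s1 9 w \<noteq> arr s1 9 w" using col[of w] by arith
      then have "?c x \<noteq> ?c w" using xw(2) by simp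
      then show ?thesis using xw(1) True unfolding e_def by (auto simp: doubleton_eq_iff)
    next
      case False
      then have "x \<notin> \<epsilon> (arr s 8 j)" using later that by simp
      then show ?thesis using that False I1 i by auto
    qed
    have I2: "I s2" if "intact s2" "reg s2 10 = i" "arr s2 9 = ?c" "\<And>a. a \<noteq> 9 \<Longrightarrow> arr s2 a = arr s1 a" for s2
      unfolding I_def using that(1,2,4) i(2) col proper I1 by (simp add: that(3))
    show ?case
      using b b' own_le
      by (simp add: I2 i(1) same intactD[OF st] e_def[symmetric] x_def[symmetric] w_def[symmetric] intact_def)
  next
    case (3 t s')
    note I1 = 3(1)[unfolded I_def]
    then have st: "intact s'" by simp
    then have "reg s' 10 = 0" using 3(2) intactD[OF st] by simp
    moreover have "\<exists>i<reg s 10. arr s 8 i = e" if "e \<in> M" for e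
      using S M that by (auto simp: stack_ok_def)
    ultimately have "\<forall>e\<in>M. arr s' 9 (a0 e) \<noteq> arr s' 9 (a1 e)" using I1 by (metis zero_le)
    then show ?case using I1 3(3) s(3) by simp
  qed
qed

lemma locate_owner_runs:
  assumes s: "intact s" "reg s 4 < m" "arr s 7 (reg s 4) = Suc x" "\<epsilon> (reg s 4) = {x, w}"
    and col: "arr s 9 x \<le> 1"
  shows "runs W locate_owner s (\<lambda>t s'. t = 8 \<and> intact s' \<and> arr s' = arr s \<and> reg s' 4 = reg s 4 \<and>
    reg s' 5 = x \<and> reg s' 8 = w \<and> reg s' 6 = arr s 9 x \<and> reg s' 9 = mk (reg s 4))"
proof -
  let ?e = "reg s 4"
  have sum: "a0 ?e + a1 ?e = x + w" using s(4) ends_neq[OF s(2)] by (auto simp: doubleton_eq_iff)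
  have "x < n" "w < n" using s(4) ends_less[OF s(2)] by (auto simp: doubleton_eq_iff)
  then have b: "Suc x \<le> W" "x \<le> W" "a0 ?e \<le> W" "a1 ?e \<le> W" "x + w \<le> W" "w \<le> W" "mk ?e \<le> W"
    "arr s 9 x \<le> W"
    using W ends_less[OF s(2)] mk_le[OF s(2)] col by auto
  show ?thesis
    using b by (simp add: locate_owner_def intactD[OF s(1)] s(3) sum intact_def)
qed

lemma write_arcs_runs:
  assumes s: "intact s" and col: "\<And>v. arr s 9 v \<le> 1"
    and own: "\<And>e. e < m \<Longrightarrow> arr s 7 e \<noteq> 0 \<and> arr s 7 e - 1 \<in> \<epsilon> e"
  shows "runs W write_arcs s (\<lambda>t s'. t \<le> 13 * m + 2 \<and> (\<forall>e<m. \<exists>w. \<epsilon> e = {arr s 7 e - 1, w} \<and>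
    (if arr s 9 (arr s 7 e - 1) = mk e then arr s' 3 e = arr s 7 e - 1 \<and> arr s' 4 e = w
     else arr s' 3 e = w \<and> arr s' 4 e = arr s 7 e - 1)))"
proof -
  define G where "G s' e \<longleftrightarrow> (\<exists>w. \<epsilon> e = {arr s 7 e - 1, w} \<and>
    (if arr s 9 (arr s 7 e - 1) = mk e then arr s' 3 e = arr s 7 e - 1 \<and> arr s' 4 e = w
     else arr s' 3 e = w \<and> arr s' 4 e = arr s 7 e - 1))" for s' :: ram_state and e
  define I where "I s' \<longleftrightarrow> intact s' \<and> reg s' 4 \<le> m \<and> (\<forall>e<reg s' 4. G s' e) \<and>
    arr s' 7 = arr s 7 \<and> arr s' 9 = arr s 9" for s'
  show ?thesis
    unfolding write_arcs_def G_def[symmetric]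
    apply simp
    apply (rule runs_Loop[where I = I and \<phi> = "\<lambda>s. 13 * (m - reg s 4)"])
    subgoal using s by (auto simp: I_def intact_def)
    subgoal premises prems for s1
    proof -
      have st: "intact s1" using prems by (simp add: I_def)
      let ?e = "reg s1 4"
      have i: "?e < m" using prems intactD[OF st] by simp
      obtain x where x: "arr s 7 ?e = Suc x" using own[OF i] by (cases "arr s 7 ?e") auto
      define w where "w = a0 ?e + a1 ?e - x"
      have xw: "\<epsilon> ?e = {x, w}" using own[OF i] x ends_neq[OF i] by (auto simp: w_def)
      have same: "arr s1 7 = arr s 7" "arr s1 9 = arr s 9" using prems by (simp_all add: I_def)
      have b: "Suc ?e \<le> W" using W i by simp
      have step: "13 * (m - ?e) = 13 + 13 * (m - Suc ?e)" using i by simp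
      have I2: "I s2" if s2: "intact s2" "reg s2 4 = Suc ?e" "arr s2 7 = arr s1 7" "arr s2 9 = arr s1 9"
          "\<And>f. f \<noteq> ?e \<Longrightarrow> arr s2 3 f = arr s1 3 f" "\<And>f. f \<noteq> ?e \<Longrightarrow> arr s2 4 f = arr s1 4 f"
          "if arr s 9 x = mk ?e then arr s2 3 ?e = x \<and> arr s2 4 ?e = w
           else arr s2 3 ?e = w \<and> arr s2 4 ?e = x" for s2
      proof -
        have "G s2 f" if "f < ?e" for f
        proof -
          have "G s1 f" using prems that by (simp add: I_def)
          moreover have "arr s2 3 f = arr s1 3 f" "arr s2 4 f = arr s1 4 f"
            using s2(5,6)[of f] that by simp_all
          ultimately show ?thesis by (simp only: G_def)
        qed
        moreover have "G s2 ?e" unfolding G_def using xw s2(7) by (intro exI[of _ w]) (simp add: x)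
        ultimately show ?thesis using s2(1-4) same i by (simp add: I_def less_Suc_eq)
      qed
      show ?thesis
      proof (simp only: runs_Seq, rule runs_mono[OF locate_owner_runs[of s1 x w]], goal_cases)
        case (6 t s2)
        then have "intact s2" by simp
        note s2 = intactD[OF this]
        show ?case using 6 b step s2 by (simp add: I2 intact_def same)
      qed (use st i x xw col same in simp_all)
    qed
    subgoal premises prems for t s'
    proof -
      have st: "intact s'" using prems by (simp add: I_def)
      then have "reg s' 4 = m" using prems intactD[OF st] by (simp add: I_def)
      then show ?thesis using prems by (simp add: I_def)
    qed
    done
qed

text \<open>Here \<open>leaf\<close> is all that is kept of the acyclicity of T, and the existence
  of \<open>own\<close> all that is kept of the pseudoforest. The owner map in the conclusion is the
  one computed by the program.\<close>

lemma orient_runs: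
  fixes M\<^sub>T M\<^sub>P :: "nat set"
  defines "M\<^sub>T \<equiv> {e. e < m \<and> mk e = 1}" and "M\<^sub>P \<equiv> {e. e < m \<and> mk e = 0}"
  assumes s: "reg s = (\<lambda>_. 0)(0 := n, 1 := m)" "arr s 0 = a0" "arr s 1 = a1" "arr s 2 = mk"
      "\<And>a. a > 2 \<Longrightarrow> arr s a = (\<lambda>_. 0)"
    and leaf: "\<And>A. A \<subseteq> M\<^sub>T \<Longrightarrow> A \<noteq> {} \<Longrightarrow> \<exists>v. deg A v = 1"
    and owner: "inj_on own M\<^sub>P" "\<And>e. e \<in> M\<^sub>P \<Longrightarrow> own e \<in> \<epsilon> e"
  shows "runs W orient s (\<lambda>t s'. t \<le> 159 * m + 10 * n + 18 \<and> (\<exists>own col.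
    inj_on own M\<^sub>P \<and> (\<forall>e\<in>M\<^sub>T. col (a0 e) \<noteq> col (a1 e)) \<and>
    (\<forall>e<m. \<exists>w. \<epsilon> e = {own e, w} \<and>
      (if col (own e) \<longleftrightarrow> e \<in> M\<^sub>T then arr s' 3 e = own e \<and> arr s' 4 e = w
       else arr s' 3 e = w \<and> arr s' 4 e = own e))))"
proof -
  have sub: "M\<^sub>T \<subseteq> {..<m}" "M\<^sub>P \<subseteq> {..<m}" and dis: "M\<^sub>T \<inter> M\<^sub>P = {}"
    and un: "\<And>e. e < m \<Longrightarrow> e \<in> M\<^sub>T \<or> e \<in> M\<^sub>P"
    using mk_le unfolding M\<^sub>T_def M\<^sub>P_def by (force simp: le_Suc_eq)+
  have cardM: "card M\<^sub>T \<le> m" "card M\<^sub>P \<le> m"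
    using sub[THEN card_mono[rotated]] by auto
  define tree_done where "tree_done s' \<longleftrightarrow> intact s' \<and>
    (\<forall>e\<in>M\<^sub>T. arr s' 7 e \<noteq> 0 \<and> arr s' 7 e - 1 \<in> \<epsilon> e) \<and>
    (\<forall>v. arr s' 9 v \<le> 1) \<and> (\<forall>e\<in>M\<^sub>T. arr s' 9 (a0 e) \<noteq> arr s' 9 (a1 e))" for s'
  define P1 where "P1 s' \<longleftrightarrow> intact s' \<and> counts M\<^sub>T s' \<and> reg s' 10 = 0 \<and>
    arr s' 7 = (\<lambda>_. 0) \<and> arr s' 9 = (\<lambda>_. 0)" for s'
  define P2 where "P2 s' \<longleftrightarrow> intact s' \<and> counts {} s' \<and> stack_ok M\<^sub>T (arr s' 7) (arr s' 8) (reg s' 10) \<and>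
    reg s' 10 \<le> m \<and> (\<forall>e\<in>M\<^sub>T. arr s' 7 e \<noteq> 0) \<and> (\<forall>e. e \<notin> M\<^sub>T \<longrightarrow> arr s' 7 e = 0) \<and>
    arr s' 9 = (\<lambda>_. 0)" for s'
  \<comment> \<open>\<open>counts {}\<close> says that the degree and sum arrays are 0 again;
    together with the unset owners outside T this lets the second round start like the
    first.\<close>
  define P3 where "P3 s' \<longleftrightarrow> tree_done s' \<and> counts {} s' \<and> (\<forall>e. e \<notin> M\<^sub>T \<longrightarrow> arr s' 7 e = 0)" for s'
  define P4 where "P4 s' \<longleftrightarrow> P3 s' \<and> reg s' 3 = 0" for s'
  define P5 where "P5 s' \<longleftrightarrow> tree_done s' \<and> counts M\<^sub>P s' \<and> reg s' 10 = 0 \<and>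
    (\<forall>e. e \<notin> M\<^sub>T \<longrightarrow> arr s' 7 e = 0)" for s'
  define P6 where "P6 s' \<longleftrightarrow> tree_done s' \<and> owned M\<^sub>P s' {} s' \<and> (\<forall>v. deg (alive M\<^sub>P s') v \<in> {0, 2})"
    for s'
  define P7 where "P7 s' \<longleftrightarrow> tree_done s' \<and> inj_on (arr s' 7) M\<^sub>P \<and>
    (\<forall>e<m. arr s' 7 e \<noteq> 0 \<and> arr s' 7 e - 1 \<in> \<epsilon> e)" for s'
  let ?R = "\<lambda>s'. \<exists>own col. inj_on own M\<^sub>P \<and> (\<forall>e\<in>M\<^sub>T. col (a0 e) \<noteq> col (a1 e)) \<and>
    (\<forall>e<m. \<exists>w. \<epsilon> e = {own e, w} \<and>
      (if col (own e) \<longleftrightarrow> e \<in> M\<^sub>T then arr s' 3 e = own e \<and> arr s' 4 e = w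
       else arr s' 3 e = w \<and> arr s' 4 e = own e))"
  let ?s1 = "s\<lparr>reg := (reg s)(2 := 1)\<rparr>" and ?s2 = "s\<lparr>reg := (reg s)(2 := 1, 3 := 1)\<rparr>"
  have W1: "1 \<le> W" using W by simp
  have c1: "runs W (Do (Const 2 1)) s (\<lambda>t s'. t \<le> 1 \<and> s' = ?s1)" using W1 by simp
  have c2: "runs W (Do (Const 3 1)) s' (\<lambda>t s'. t \<le> 1 \<and> s' = ?s2)" if "s' = ?s1" for s'
    using W1 that by simp
  have r1: "runs W init_degrees s' (\<lambda>t s'. t \<le> 20 * m + 3 \<and> P1 s')" if "s' = ?s2" for s'
  proof (rule runs_mono[OF init_degrees_runs[where b = 1]])
    show "intact s'" "arr s' 5 = (\<lambda>_. 0)" "arr s' 6 = (\<lambda>_. 0)" "reg s' 3 = 1"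
      using s that by (auto simp: intact_def)
  qed (use s that in \<open>auto simp: P1_def M\<^sub>T_def\<close>)
  have r2: "runs W strip_leaves s' (\<lambda>t s'. t \<le> 24 * m + 5 * n + 2 \<and> P2 s')" if P1: "P1 s'" for s'
  proof (rule runs_mono[OF strip_leaves_runs[OF _ sub(1)]], goal_cases)
    case (5 t s2)
    \<comment> \<open>Stripping has stopped without leaves, whereas any remaining edges of T would
      have one.\<close>
    have "alive M\<^sub>T s2 = {}"
    proof (rule ccontr)
      assume "alive M\<^sub>T s2 \<noteq> {}"
      then have "\<exists>v. deg (alive M\<^sub>T s2) v = 1" by (intro leaf) (auto simp: alive_def)
      with 5 show False by blast
    qed
    moreover from this have "\<forall>e\<in>M\<^sub>T. arr s2 7 e \<noteq> 0" by (auto simp: alive_def)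
    moreover from calculation have "counts {} s2" using 5 by metis
    ultimately show ?case using 5 P1 cardM by (simp add: P1_def P2_def)
  qed (use P1 in \<open>auto simp: P1_def alive_def\<close>)
  have r3: "runs W two_colour s' (\<lambda>t s'. t \<le> 12 * m + 1 \<and> P3 s')" if P2: "P2 s'" for s'
  proof (rule runs_mono[OF two_colour_runs[OF _ sub(1)]], goal_cases)
    case (6 t s2)
    have "arr s' 7 e - 1 \<in> \<epsilon> e" if "e \<in> M\<^sub>T" for e
      using P2 that unfolding P2_def stack_ok_def by metis
    with 6 P2 show ?case by (auto simp: P2_def P3_def tree_done_def counts_def)
  qed (use P2 in \<open>auto simp: P2_def\<close>)
  have c4: "runs W (Do (Const 3 0)) s' (\<lambda>t s'. t \<le> 1 \<and> P4 s')" if "P3 s'" for s'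
    using that by (simp add: P4_def P3_def tree_done_def intact_def counts_def)
  have r5: "runs W init_degrees s' (\<lambda>t s'. t \<le> 20 * m + 3 \<and> P5 s')" if P4: "P4 s'" for s'
  proof (rule runs_mono[OF init_degrees_runs[where b = 0]])
    show "intact s'" "arr s' 5 = (\<lambda>_. 0)" "arr s' 6 = (\<lambda>_. 0)" "reg s' 3 = 0"
      using P4 by (auto simp: P4_def P3_def tree_done_def counts_def)
  qed (use P4 in \<open>auto simp: P5_def P4_def P3_def tree_done_def M\<^sub>P_def\<close>)
  have r6: "runs W strip_leaves s' (\<lambda>t s'. t \<le> 24 * m + 5 * n + 2 \<and> P6 s')" if P5: "P5 s'" for s'
  proof (rule runs_mono[OF strip_leaves_runs[OF _ sub(2)]], goal_cases)
    case (5 t s2)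
    have "deg (alive M\<^sub>P s2) v \<in> {0, 2}" for v
      unfolding deg_def
    proof (rule owned_degrees_zero_or_two)
      show "finite (alive M\<^sub>P s2)"
        by (rule finite_subset[of _ "{..<m}"]) (use sub in \<open>auto simp: alive_def\<close>)
      show "inj_on own (alive M\<^sub>P s2)"
        by (rule inj_on_subset[OF owner(1)]) (auto simp: alive_def)
    qed (use sub(2) owner(2) ends_neq 5 in \<open>auto simp: alive_def deg_def card_insert_if subset_iff\<close>)
    moreover have "inj_on (arr s2 7) {e \<in> M\<^sub>P. arr s2 7 e \<noteq> 0}" using 5 by (blast intro: stack_ok_inj)
    moreover have "arr s2 7 e - 1 \<in> \<epsilon> e \<and> deg (alive M\<^sub>P s2) (arr s2 7 e - 1) = 0"
      if e: "e \<in> M\<^sub>P" "arr s2 7 e \<noteq> 0" for e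
    proof -
      have ok: "stack_ok M\<^sub>P (arr s2 7) (arr s2 8) (reg s2 10)" using 5 by blast
      obtain i where i: "i < reg s2 10" "arr s2 8 i = e" using ok e unfolding stack_ok_def by blast
      then have "edges_at \<epsilon> (alive M\<^sub>P s2) (arr s2 7 e - 1) = {}"
        using ok unfolding stack_ok_def edges_at_def alive_def by blast
      moreover have "arr s2 7 e - 1 \<in> \<epsilon> e" using ok i unfolding stack_ok_def by blast
      ultimately show ?thesis by (simp add: deg_def)
    qed
    moreover have "tree_done s2"
    proof -
      have "arr s2 7 e = arr s' 7 e" if "e \<in> M\<^sub>T" for e using 5 that dis by blast
      with 5 P5 show ?thesis by (auto simp: P5_def tree_done_def)
    qed
    ultimately show ?case using 5 cardM by (auto simp: P6_def owned_def)
  qed (use P5 dis in \<open>auto simp: P5_def tree_done_def alive_def\<close>)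
  have r7: "runs W break_cycles s' (\<lambda>t s'. t \<le> 46 * m + 2 \<and> P7 s')" if P6: "P6 s'" for s'
  proof (rule runs_mono[OF break_cycles_runs[OF _ sub(2)]], goal_cases)
    case (3 e)
    then have e: "arr s' 7 e \<noteq> 0" "arr s' 7 e - 1 \<in> \<epsilon> e"
      using un[of e] P6 by (auto simp: P6_def tree_done_def)
    then show ?case using ends_less[OF 3(1)] by auto
  next
    case (5 t s2)
    have ow: "owned M\<^sub>P s' {} s2" and nz: "\<And>e. e < m \<Longrightarrow> arr s2 7 e \<noteq> 0" using 5 by blast+
    have "arr s2 7 e = arr s' 7 e" if "e \<in> M\<^sub>T" for e using ow that dis unfolding owned_def by blast
    then have td: "tree_done s2" using ow P6 by (auto simp: P6_def tree_done_def owned_def)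
    have "{e \<in> M\<^sub>P. arr s2 7 e \<noteq> 0} = M\<^sub>P" using nz sub by auto
    then have "inj_on (arr s2 7) M\<^sub>P" using ow by (simp add: owned_def)
    moreover have "arr s2 7 e - 1 \<in> \<epsilon> e" if "e < m" for e
      using un[OF that] nz[OF that] td ow by (auto simp: tree_done_def owned_def)
    ultimately show ?case using td nz 5 cardM by (auto simp: P7_def)
  qed (use P6 in \<open>auto simp: P6_def tree_done_def\<close>)
  have r8: "runs W write_arcs s' (\<lambda>t s'. t \<le> 13 * m + 2 \<and> ?R s')" if P7: "P7 s'" for s'
  proof (rule runs_mono[OF write_arcs_runs], goal_cases)
    case (4 t s2)
    let ?own = "\<lambda>e. arr s' 7 e - 1" and ?col = "\<lambda>v. arr s' 9 v = 1"
    have inj: "inj_on ?own M\<^sub>P"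
    proof (rule inj_onI)
      fix e f assume ef: "e \<in> M\<^sub>P" "f \<in> M\<^sub>P" "?own e = ?own f"
      then have "arr s' 7 e \<noteq> 0" "arr s' 7 f \<noteq> 0" using P7 sub by (auto simp: P7_def)
      with ef have "arr s' 7 e = arr s' 7 f" by simp
      with ef P7 show "e = f" by (auto simp: P7_def dest: inj_onD)
    qed
    have le: "arr s' 9 v \<le> 1" for v using P7 by (simp add: P7_def tree_done_def)
    have proper: "\<forall>e\<in>M\<^sub>T. ?col (a0 e) \<noteq> ?col (a1 e)"
    proof
      fix e assume "e \<in> M\<^sub>T"
      then have "arr s' 9 (a0 e) \<noteq> arr s' 9 (a1 e)" using P7 by (simp add: P7_def tree_done_def)
      with le[of "a0 e"] le[of "a1 e"] show "?col (a0 e) \<noteq> ?col (a1 e)" by linarith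
    qed
    have eqv: "arr s' 9 v = mk e \<longleftrightarrow> (?col v \<longleftrightarrow> e \<in> M\<^sub>T)" if "e < m" for v e
      using le[of v] mk_le[OF that] that unfolding M\<^sub>T_def by (simp add: le_Suc_eq) linarith
    have arcs: "\<forall>e<m. \<exists>w. \<epsilon> e = {?own e, w} \<and>
      (if ?col (?own e) \<longleftrightarrow> e \<in> M\<^sub>T then arr s2 3 e = ?own e \<and> arr s2 4 e = w
       else arr s2 3 e = w \<and> arr s2 4 e = ?own e)"
    proof (intro allI impI)
      fix e assume e: "e < m"
      with 4 show "\<exists>w. \<epsilon> e = {?own e, w} \<and>
        (if ?col (?own e) \<longleftrightarrow> e \<in> M\<^sub>T then arr s2 3 e = ?own e \<and> arr s2 4 e = w
         else arr s2 3 e = w \<and> arr s2 4 e = ?own e)"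
        unfolding eqv[OF e, symmetric] by blast
    qed
    have "?R s2" by (intro exI[of _ ?own] exI[of _ ?col] conjI inj proper arcs)
    with 4 show ?case by (elim conjE) (rule conjI)
  qed (use P7 in \<open>auto simp: P7_def tree_done_def\<close>)
  \<comment> \<open>The coefficients of \<open>m\<close> add up to 20 + 24 + 12 + 20 + 24 + 46 + 13
    = 159, where 46 = 24 + 22 comes from \<open>break_cycles\<close>.\<close>
  have "runs W orient s (\<lambda>t s'. t \<le> 1 + (1 + ((20 * m + 3) + ((24 * m + 5 * n + 2) + ((12 * m + 1) +
      (1 + ((20 * m + 3) + ((24 * m + 5 * n + 2) + ((46 * m + 2) + (13 * m + 2))))))))) \<and> ?R s')"
    unfolding orient_def block.simps
    by (intro runs_SeqI[OF c1] runs_SeqI[OF c2] runs_SeqI[OF r1] runs_SeqI[OF r2] runs_SeqI[OF r3]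
        runs_SeqI[OF c4] runs_SeqI[OF r5] runs_SeqI[OF r6] runs_SeqI[OF r7] r8)
  then show ?thesis by (rule runs_mono) (simp add: algebra_simps)
qed

end

section \<open>From owner maps and arrays back to multigraphs\<close>

lemma spanning_tree_pseudoforest_orientation:
  assumes G: "finite_loopless G" and un: "edge_disjoint_union G T P"
    and T: "spanning_tree_of T G" and P: "odd_pseudoforest P"
  shows "\<exists>D. orientation_of D G \<and> (\<nexists>vs es. closed_antidirected_trail D vs es)"
proof -
  have nc: "\<nexists>C. cycle_edges T C" and fT: "finite_loopless T"
    using T by (auto simp: spanning_tree_of_def tree_multigraph_def)
  have odd: "\<And>C. cycle_edges P C \<Longrightarrow> odd (card C)" and pf: "pseudoforest P"
    using P by (auto simp: odd_pseudoforest_def)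
  have endsT: "\<And>e. e \<in> medges T \<Longrightarrow> ends T e = ends G e"
    and endsP: "\<And>e. e \<in> medges P \<Longrightarrow> ends P e = ends G e"
    using un unfolding edge_disjoint_union_def submultigraph_def by auto
  obtain own\<^sub>P where own\<^sub>P: "inj_on own\<^sub>P (medges P)" "\<And>e. e \<in> medges P \<Longrightarrow> own\<^sub>P e \<in> ends P e"
    using pseudoforest_owner[OF pf] by blast
  obtain col where col: "\<And>e. e \<in> medges T \<Longrightarrow> \<exists>x y. ends T e = {x, y} \<and> col x \<and> \<not> col y"
    using forest_colouring[OF fT nc] by blast
  \<comment> \<open>An edge of T gets an arbitrary end as its owner: the proper colouring of T makes
    the direction independent of the choice.\<close>
  define own where "own e = (if e \<in> medges P then own\<^sub>P e else SOME x. x \<in> ends G e)" for e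
  have own: "own e \<in> ends G e" if "e \<in> medges G" for e
  proof -
    have "ends G e \<noteq> {}" using G that by (auto simp: finite_loopless_def)
    then show ?thesis using own\<^sub>P(2) endsP by (auto simp: own_def some_in_eq)
  qed
  have "\<forall>e\<in>medges G. \<exists>w. ends G e = {own e, w}"
  proof
    fix e assume e: "e \<in> medges G"
    then have "card (ends G e) = 2" using G by (simp add: finite_loopless_def)
    with own[OF e] show "\<exists>w. ends G e = {own e, w}" by (auto simp: card_2_iff)
  qed
  then obtain oth where oth: "\<And>e. e \<in> medges G \<Longrightarrow> ends G e = {own e, oth e}"
    by metis
  let ?fwd = "\<lambda>e. col (own e) \<longleftrightarrow> e \<in> medges T"
  define D where "D = \<lparr>verts = mverts G, arcs = medges G,
    tail = (\<lambda>e. if ?fwd e then own e else oth e), head = (\<lambda>e. if ?fwd e then oth e else own e)\<rparr>"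
  have "orientation_of D G" using oth by (auto simp: orientation_of_def D_def)
  moreover have inj: "inj_on own (medges P)" using own\<^sub>P(1) by (simp add: own_def inj_on_def)
  have "\<nexists>vs es. closed_antidirected_trail D vs es"
  proof (rule owner_orientation_no_trail[OF G un nc odd inj])
    show "\<exists>x y. ends G e = {x, y} \<and> col x \<and> \<not> col y" if "e \<in> medges T" for e
      using col[OF that] endsT[OF that] by simp
    show "\<exists>w. ends G e = {own e, w} \<and> (if ?fwd e then tail D e = own e \<and> head D e = w
       else tail D e = w \<and> head D e = own e)" if "e \<in> medges G" for e
      using oth[OF that] by (intro exI[of _ "oth e"]) (simp add: D_def)
    show "arcs D = medges G" by (simp add: D_def)
  qed
  ultimately show ?thesis by blast
qed

text \<open>The word bound has the shape \<open>d * sz ^ d\<close> with \<open>d = 3\<close>. A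
  spanning tree is connected, hence nonempty, so there is at least one vertex; this absorbs the
  constant in the word bound and gives \<open>10 * n + 18 \<le> 159 * n\<close> in the time
  bound.\<close>

lemma orient_correct:
  assumes G: "finite_loopless G" and un: "edge_disjoint_union G T P"
    and T: "spanning_tree_of T G" and P: "odd_pseudoforest P" and s: "encodes G T s"
  shows "runs (3 * graph_size G ^ 3) orient s (\<lambda>t s'. t \<le> 159 * graph_size G \<and>
    orientation_of (decoded_digraph G s') G \<and>
    (\<nexists>vs es. closed_antidirected_trail (decoded_digraph G s') vs es))"
proof -
  define a0 a1 mk where a: "a0 = arr s 0" "a1 = arr s 1" "mk = arr s 2"
  obtain n m where n: "mverts G = {..<n}" and m: "medges G = {..<m}"
    and r: "reg s = (\<lambda>_. 0)(0 := n, 1 := m)"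
    and e: "\<And>e. e < m \<Longrightarrow> ends G e = {a0 e, a1 e}"
    and mk: "\<And>e. e < m \<Longrightarrow> mk e = (if e \<in> medges T then 1 else 0)"
    and z: "\<And>a i. a > 2 \<or> i \<ge> m \<Longrightarrow> arr s a i = 0"
    using s unfolding encodes_def a by blast
  have nc: "\<nexists>C. cycle_edges T C" and fT: "finite_loopless T" and "mverts T \<noteq> {}" "mverts T = mverts G"
    using T by (auto simp: spanning_tree_of_def tree_multigraph_def connected_multigraph_def)
  then have n0: "n > 0" using n by auto
  have odd: "\<And>C. cycle_edges P C \<Longrightarrow> odd (card C)" and pf: "pseudoforest P"
    using P by (auto simp: odd_pseudoforest_def)
  have endsT: "\<And>e. e \<in> medges T \<Longrightarrow> ends T e = ends G e"
    and endsP: "\<And>e. e \<in> medges P \<Longrightarrow> ends P e = ends G e"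
    and TP: "{..<m} = medges T \<union> medges P" "medges T \<inter> medges P = {}"
    using un m unfolding edge_disjoint_union_def submultigraph_def by auto
  have size: "graph_size G = n + m" by (simp add: graph_size_def n m)
  let ?W = "3 * graph_size G ^ 3"
  have W: "2 * n + m * m + m + 1 \<le> 3 * (n + m) ^ 3"
  proof -
    obtain k where k: "n = Suc k" using n0 by (cases n) auto
    show ?thesis unfolding k by (simp add: power3_eq_cube algebra_simps)
  qed
  interpret edge_arrays n m ?W a0 a1 mk
  proof (unfold_locales, goal_cases)
    case (1 f)
    then have "ends G f \<subseteq> mverts G" using G m by (auto simp: finite_loopless_def)
    with e[OF 1] n show ?case by auto
  next
    case (2 f)
    then have "ends G f \<subseteq> mverts G" using G m by (auto simp: finite_loopless_def)
    with e[OF 2] n show ?case by auto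
  next
    case (3 f)
    then have "card (ends G f) = 2" using G m by (auto simp: finite_loopless_def)
    with e[OF 3] show ?case by auto
  qed (use W in \<open>auto simp: mk size\<close>)
  have lt: "e < m \<longleftrightarrow> e \<in> medges T \<or> e \<in> medges P" for e using TP(1) by (metis Un_iff lessThan_iff)
  have MT: "{e. e < m \<and> mk e = 1} = medges T" and MP: "{e. e < m \<and> mk e = 0} = medges P"
    using TP(2) mk lt by (auto split: if_splits)
  obtain own where own: "inj_on own (medges P)" "\<And>e. e \<in> medges P \<Longrightarrow> own e \<in> ends P e"
    using pseudoforest_owner[OF pf] by blast
  have \<epsilon>G: "\<epsilon> e = ends G e" if "e < m" for e using e[OF that] by simp
  have leaf: "\<exists>v. deg A v = 1" if A: "A \<subseteq> medges T" "A \<noteq> {}" for A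
  proof -
    let ?T = "T\<lparr>medges := A\<rparr>"
    have "finite_loopless ?T" "\<nexists>C. cycle_edges ?T C" "medges ?T \<noteq> {}"
      using finite_loopless_edges_update[OF fT A(1)] acyclic_edges_update[OF nc A(1)] A(2) by auto
    then obtain a f where "edges_at (ends ?T) (medges ?T) a = {f}"
      using acyclic_two_leaves by metis
    moreover have "\<epsilon> g = ends T g" if "g \<in> A" for g
      using that A(1) endsT[of g] \<epsilon>G[of g] lt[of g] by auto
    then have "edges_at \<epsilon> A a = edges_at (ends T) A a"
      unfolding edges_at_def by (intro Collect_cong) auto
    ultimately show ?thesis by (intro exI[of _ a]) (simp add: deg_def)
  qed
  have own\<epsilon>: "own f \<in> \<epsilon> f" if "f \<in> medges P" for f
  proof -
    have "f < m" using that TP by auto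
    then show ?thesis using own(2)[OF that] endsP[OF that] \<epsilon>G by simp
  qed
  have "runs ?W orient s (\<lambda>t s'. t \<le> 159 * m + 10 * n + 18 \<and> (\<exists>own col.
      inj_on own (medges P) \<and> (\<forall>e\<in>medges T. col (a0 e) \<noteq> col (a1 e)) \<and>
      (\<forall>e<m. \<exists>w. \<epsilon> e = {own e, w} \<and>
        (if col (own e) \<longleftrightarrow> e \<in> medges T then arr s' 3 e = own e \<and> arr s' 4 e = w
         else arr s' 3 e = w \<and> arr s' 4 e = own e))))"
    by (rule orient_runs[of s own, unfolded MT MP])
      (use r z leaf own(1) own\<epsilon> in \<open>auto simp: a fun_eq_iff\<close>)
  then show ?thesis
  proof (rule runs_mono, elim conjE exE)
    fix t :: nat and s' own and col :: "nat \<Rightarrow> bool"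
    let ?D = "decoded_digraph G s'"
    assume t: "t \<le> 159 * m + 10 * n + 18" and inj: "inj_on own (medges P)"
      and col: "\<forall>e\<in>medges T. col (a0 e) \<noteq> col (a1 e)"
      and or: "\<forall>e<m. \<exists>w. \<epsilon> e = {own e, w} \<and>
        (if col (own e) \<longleftrightarrow> e \<in> medges T then arr s' 3 e = own e \<and> arr s' 4 e = w
         else arr s' 3 e = w \<and> arr s' 4 e = own e)"
    have or': "\<exists>w. ends G f = {own f, w} \<and>
        (if col (own f) \<longleftrightarrow> f \<in> medges T then tail ?D f = own f \<and> head ?D f = w
         else tail ?D f = w \<and> head ?D f = own f)" if "f \<in> medges G" for f
    proof -
      have f: "f < m" using that m by simp
      show ?thesis
        unfolding e[OF f] decoded_digraph_def pre_digraph.simps by (rule or[rule_format, OF f])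
    qed
    have "{tail ?D f, head ?D f} = ends G f" if "f \<in> medges G" for f
      using or'[OF that] by (auto split: if_splits)
    then have "orientation_of ?D G" by (simp add: orientation_of_def decoded_digraph_def)
    moreover have "\<nexists>vs es. closed_antidirected_trail ?D vs es"
    proof (rule owner_orientation_no_trail[OF G un nc odd inj _ _ or'])
      show "\<exists>x y. ends G f = {x, y} \<and> col x \<and> \<not> col y" if "f \<in> medges T" for f
      proof -
        have "f < m" using that TP by auto
        note f = e[OF this]
        have "col (a0 f) \<noteq> col (a1 f)" using col that by blast
        then consider "col (a0 f)" "\<not> col (a1 f)" | "col (a1 f)" "\<not> col (a0 f)" by blast
        then show ?thesis
        proof cases
          case 1
          with f show ?thesis by blast
        next
          case 2
          with f show ?thesis by (intro exI[of _ "a1 f"] exI[of _ "a0 f"]) auto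
        qed
      qed
    qed (simp_all add: decoded_digraph_def)
    moreover have "t \<le> 159 * graph_size G" using t n0 unfolding size by simp
    ultimately show "t \<le> 159 * graph_size G \<and> orientation_of ?D G \<and>
      (\<nexists>vs es. closed_antidirected_trail ?D vs es)" by blast
  qed
qed

theorem theorem6p7:
  shows "(\<forall>(G :: ('v, 'e) multigraph) T P.
            finite_loopless G \<and> edge_disjoint_union G T P \<and> spanning_tree_of T G \<and>
            odd_pseudoforest P \<longrightarrow>
            (\<exists>D. orientation_of D G \<and> (\<nexists>vs es. closed_antidirected_trail D vs es))) \<and>
         solvable_in_linear_time
           (\<lambda>(G, T, P). graph_size G)
           (\<lambda>(G, T, P) s.
              finite_loopless G \<and> edge_disjoint_union G T P \<and> spanning_tree_of T G \<and>
              odd_pseudoforest P \<and> encodes G T s)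
           (\<lambda>(G, T, P) s.
              orientation_of (decoded_digraph G s) G \<and>
              (\<nexists>vs es. closed_antidirected_trail (decoded_digraph G s) vs es))"
proof (intro conjI allI impI)
  fix G :: "('v, 'e) multigraph" and T P
  assume "finite_loopless G \<and> edge_disjoint_union G T P \<and> spanning_tree_of T G \<and> odd_pseudoforest P"
  then show "\<exists>D. orientation_of D G \<and> (\<nexists>vs es. closed_antidirected_trail D vs es)"
    using spanning_tree_pseudoforest_orientation by blast
next
  have "\<exists>t s'. exec (3 * graph_size G ^ 3) orient s t s' \<and> t \<le> 159 * graph_size G \<and>
      orientation_of (decoded_digraph G s') G \<and>
      (\<nexists>vs es. closed_antidirected_trail (decoded_digraph G s') vs es)"
    if "finite_loopless G \<and> edge_disjoint_union G T P \<and> spanning_tree_of T G \<and>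
      odd_pseudoforest P \<and> encodes G T s" for G T P s
    using orient_correct[of G T P s] that unfolding runs_def by blast
  then show "solvable_in_linear_time
           (\<lambda>(G, T, P). graph_size G)
           (\<lambda>(G, T, P) s.
              finite_loopless G \<and> edge_disjoint_union G T P \<and> spanning_tree_of T G \<and>
              odd_pseudoforest P \<and> encodes G T s)
           (\<lambda>(G, T, P) s.
              orientation_of (decoded_digraph G s) G \<and>
              (\<nexists>vs es. closed_antidirected_trail (decoded_digraph G s) vs es))"
    unfolding solvable_in_linear_time_def
    by (intro exI[of _ orient] exI[of _ 159] exI[of _ 3]) (simp only: split_paired_All prod.case, blast)
qed

end
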